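(* Let $\mathcal R$ be the Ricci curvature of $\Sigma$, considered as a map $T\Sigma\to T\Sigma$, and let $R$ denote the scalar curvature of $\Sigma$. For any $X=X^j\partial_j\in T\Sigma$ it holds that $$\mathcal R(X)=\frac{1}{\gamma^4}(\mathcal P^2)^{ik}(\mathcal P^2)^{lm}\bar R_{ijkl}X^j\partial_m+\frac1{\gamma^4}\sum_{A=1}^p\Big[(\operatorname{Tr}\mathcal B_A)\mathcal B_A(X)-\mathcal B_A^2(X)\Big],$$ $$R=\frac{1}{\gamma^4}(\mathcal P^2)^{ik}(\mathcal P^2)^{jl}\bar R_{ijkl}+\frac1{\gamma^4}\sum_{A=1}^p\Big[(\operatorname{Tr}\mathcal B_A)^2-\operatorname{Tr}\mathcal B_A^2\Big],$$ where $\bar R$ is the curvature tensor of $M$ (in the first formula $m$ is also used as a summation index).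
   Context: Setting: $n\ge2$, $p\ge1$, $\Sigma$ is an $n$-dimensional manifold embedded in a Riemannian manifold $(M,\bar g)$ of dimension $n+p$, with the induced metric. Local coordinates on $M$ are $x^i$, local coordinates on $\Sigma$ are $u^1,\dots,u^n$, and the $x^i$ are regarded as functions of the $u^a$ giving the embedding. Repeated indices are summed; $i,j,k,l,m$ range over $1,\dots,n+p$ and $a,b,c$ over $1,\dots,n$. $\partial_a=\partial/\partial u^a$, $\partial_i=\partial/\partial x^i$, $e_a=(\partial_ax^i)\partial_i$ is the basis of $T\Sigma\subset TM$ (with $TM$ taken at points of $\Sigma$), $g_{ab}=\bar g(e_a,e_b)$, $g=\det(g_{ab})$. $N_A=n_A^i\partial_i$, $A=1,\dots,p$, is a local orthonormal frame of normal vector fields: $\bar g(N_A,N_B)=\delta_{AB}$, $\bar g(N_A,e_a)=0$. $\bar\nabla$ is the Levi-Civita connection of $M$, $\bar\nabla_a=\bar\nabla_{e_a}$. Curvature conventions: $\bar R(X,Y)Z=\bar\nabla_X\bar\nabla_YZ-\bar\nabla_Y\bar\nabla_XZ-\bar\nabla_{[X,Y]}Z$, $\bar R_{ijkl}=\bar g(\bar R(\partial_k,\partial_l)\partial_j,\partial_i)$; likewise for $\Sigma$, and the Ricci map is $\mathcal R^q_b=g^{ac}g^{qd}g(R(e_c,e_d)e_b,e_a)$, with scalar curvature its trace. Let $\rho$ be an arbitrary non-vanishing density on $\Sigma$, $\gamma=\sqrt g/\rho$, and define the Nambu bracket $\{f_1,\dots,f_n\}=\frac1\rho\varepsilon^{a_1\cdots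 a_n}(\partial_{a_1}f_1)\cdots(\partial_{a_n}f_n)$, $\varepsilon$ being the Levi-Civita symbol. For multi-indices $J=j_1\cdots j_{n-1}$ and $\vec a=a_1\cdots a_{n-1}$ put $\partial_{\vec a}\vec x^J=(\partial_{a_1}x^{j_1})\cdots(\partial_{a_{n-1}}x^{j_{n-1}})$, $\bar g_{IJ}=\bar g_{i_1j_1}\cdots\bar g_{i_{n-1}j_{n-1}}$, and $$\mathcal P^{iJ}=\frac{1}{\sqrt{(n-1)!}}\{x^i,x^{j_1},\dots,x^{j_{n-1}}\},\qquad \mathcal T_A^{Ij}=\frac{(-1)^n}{\sqrt{(n-1)!}}\frac{\varepsilon^{\vec a a}}{\rho}(\partial_{\vec a}\vec x^I)(\bar\nabla_aN_A)^j,$$ $$(\mathcal P^2)^{ik}=\mathcal P^{iI}\mathcal P^{kJ}\bar g_{IJ},\qquad (\mathcal B_A)^{ik}=\mathcal P^{iI}\mathcal T_A^{Jk}\bar g_{IJ}.$$ $\mathcal B_A$ is considered as a map $TM\to TM$ by lowering its second index: $\mathcal B_A(X)^i=(\mathcal B_A)^{ik}\bar g_{kj}X^j$; $\operatorname{Tr}$ is the trace of maps $TM\to TM$. *)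

theory Defs
  imports "HOL-Analysis.Analysis"
begin

section \<open>Smooth functions on open subsets of Euclidean space\<close>

definition partial :: "'k \<Rightarrow> (real^'k::finite \<Rightarrow> 'b::real_normed_vector) \<Rightarrow> real^'k \<Rightarrow> 'b" where
  "partial a f u = frechet_derivative f (at u) (axis a 1)"

primrec Ck_on :: "nat \<Rightarrow> (real^'k::finite \<Rightarrow> 'b::real_normed_vector) \<Rightarrow> (real^'k) set \<Rightarrow> bool" where
  "Ck_on 0 f W \<longleftrightarrow> continuous_on W f"
| "Ck_on (Suc r) f W \<longleftrightarrow> (\<forall>u\<in>W. f differentiable at u) \<and> (\<forall>a. Ck_on r (partial a f) W)"

definition smooth_on :: "(real^'k::finite \<Rightarrow> 'b::real_normed_vector) \<Rightarrow> (real^'k) set \<Rightarrow> bool" where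
  "smooth_on f W \<longleftrightarrow> open W \<and> (\<forall>r. Ck_on r f W)"


section \<open>Manifolds, Riemannian metrics, embeddings\<close>

text \<open>A manifold is an abstract topology together with an arbitrary smooth atlas (possibly the
  maximal one). A chart is its domain paired with its coordinate map; the values of the coordinate
  map outside the domain are irrelevant.\<close>

type_synonym ('a, 'k) chart = "'a set \<times> ('a \<Rightarrow> real^'k)"

definition is_chart :: "'a topology \<Rightarrow> ('a, 'k::finite) chart \<Rightarrow> bool" where
  "is_chart X c \<longleftrightarrow> openin X (fst c) \<and> open (snd c ` fst c) \<and>
     homeomorphic_map (subtopology X (fst c)) (top_of_set (snd c ` fst c)) (snd c)"

text \<open>Coordinate expression of a map, and the open set of coordinates on which it makes sense.\<close>

definition local_rep :: "('a, 'k::finite) chart \<Rightarrow> ('b, 'l::finite) chart \<Rightarrow> ('a \<Rightarrow> 'b) \<Rightarrow> real^'k \<Rightarrow> real^'l" where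
  "local_rep c d f = snd d \<circ> f \<circ> inv_into (fst c) (snd c)"

definition local_dom :: "('a, 'k::finite) chart \<Rightarrow> ('b, 'l::finite) chart \<Rightarrow> ('a \<Rightarrow> 'b) \<Rightarrow> (real^'k) set" where
  "local_dom c d f = snd c ` {s \<in> fst c. f s \<in> fst d}"

definition smooth_manifold :: "'a topology \<Rightarrow> ('a, 'k::finite) chart set \<Rightarrow> bool" where
  "smooth_manifold X \<A> \<longleftrightarrow> Hausdorff_space X \<and> second_countable X \<and>
     (\<forall>c\<in>\<A>. is_chart X c) \<and> (\<Union>c\<in>\<A>. fst c) = topspace X \<and>
     (\<forall>c\<in>\<A>. \<forall>d\<in>\<A>. smooth_on (local_rep c d id) (local_dom c d id))"

text \<open>A Riemannian metric is given by its components in every chart of the atlas; the last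
  conjunct is the transformation law of a covariant 2-tensor.\<close>

definition riemannian_metric ::
  "('a, 'k::finite) chart set \<Rightarrow> (('a, 'k) chart \<Rightarrow> real^'k \<Rightarrow> real^'k^'k) \<Rightarrow> bool" where
  "riemannian_metric \<A> G \<longleftrightarrow>
     (\<forall>c\<in>\<A>. smooth_on (G c) (snd c ` fst c) \<and>
        (\<forall>x\<in>snd c ` fst c. transpose (G c x) = G c x \<and> (\<forall>v. v \<noteq> 0 \<longrightarrow> v \<bullet> (G c x *v v) > 0))) \<and>
     (\<forall>c\<in>\<A>. \<forall>d\<in>\<A>. \<forall>x\<in>local_dom c d id. \<forall>i j.
        G c x $ i $ j = (\<Sum>k\<in>UNIV. \<Sum>l\<in>UNIV. partial i (local_rep c d id) x $ k *
          partial j (local_rep c d id) x $ l * G d (local_rep c d id x) $ k $ l))"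

definition riemannian_manifold ::
  "'a topology \<Rightarrow> ('a, 'k::finite) chart set \<Rightarrow> (('a, 'k) chart \<Rightarrow> real^'k \<Rightarrow> real^'k^'k) \<Rightarrow> bool" where
  "riemannian_manifold X \<A> G \<longleftrightarrow> smooth_manifold X \<A> \<and> riemannian_metric \<A> G"

definition smooth_embedding ::
  "'a topology \<Rightarrow> ('a, 'k::finite) chart set \<Rightarrow> 'b topology \<Rightarrow> ('b, 'l::finite) chart set \<Rightarrow> ('a \<Rightarrow> 'b) \<Rightarrow> bool" where
  "smooth_embedding X \<A> Y \<B> f \<longleftrightarrow> embedding_map X Y f \<and>
     (\<forall>c\<in>\<A>. \<forall>d\<in>\<B>. smooth_on (local_rep c d f) (local_dom c d f) \<and>
        (\<forall>u\<in>local_dom c d f. inj (frechet_derivative (local_rep c d f) (at u))))"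


section \<open>Levi-Civita connection and curvature in local coordinates\<close>

text \<open>Throughout, \<open>h\<close> is the matrix-valued function of metric components, and vector fields are
  given by their component functions. \<open>christoffel h k i j\<close> is the symbol with upper index \<open>k\<close>.\<close>

definition metric :: "(real^'k::finite \<Rightarrow> real^'k^'k) \<Rightarrow> real^'k \<Rightarrow> real^'k \<Rightarrow> real^'k \<Rightarrow> real" where
  "metric h x v w = (\<Sum>i\<in>UNIV. \<Sum>j\<in>UNIV. h x $ i $ j * v $ i * w $ j)"

definition christoffel :: "(real^'k::finite \<Rightarrow> real^'k^'k) \<Rightarrow> 'k \<Rightarrow> 'k \<Rightarrow> 'k \<Rightarrow> real^'k \<Rightarrow> real" where
  "christoffel h k i j x = (1/2) * (\<Sum>l\<in>UNIV. matrix_inv (h x) $ k $ l *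
     (partial i (\<lambda>y. h y $ j $ l) x + partial j (\<lambda>y. h y $ i $ l) x - partial l (\<lambda>y. h y $ i $ j) x))"

definition nabla ::
  "(real^'k::finite \<Rightarrow> real^'k^'k) \<Rightarrow> (real^'k \<Rightarrow> real^'k) \<Rightarrow> (real^'k \<Rightarrow> real^'k) \<Rightarrow> real^'k \<Rightarrow> real^'k" where
  "nabla h X Y x = (\<chi> k. (\<Sum>i\<in>UNIV. X x $ i * partial i (\<lambda>y. Y y $ k) x) +
     (\<Sum>i\<in>UNIV. \<Sum>j\<in>UNIV. christoffel h k i j x * X x $ i * Y x $ j))"

definition lie_bracket :: "(real^'k::finite \<Rightarrow> real^'k) \<Rightarrow> (real^'k \<Rightarrow> real^'k) \<Rightarrow> real^'k \<Rightarrow> real^'k" where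
  "lie_bracket X Y x =
     (\<chi> k. \<Sum>i\<in>UNIV. X x $ i * partial i (\<lambda>y. Y y $ k) x - Y x $ i * partial i (\<lambda>y. X y $ k) x)"

definition curvature ::
  "(real^'k::finite \<Rightarrow> real^'k^'k) \<Rightarrow> (real^'k \<Rightarrow> real^'k) \<Rightarrow> (real^'k \<Rightarrow> real^'k) \<Rightarrow> (real^'k \<Rightarrow> real^'k)
     \<Rightarrow> real^'k \<Rightarrow> real^'k" where
  "curvature h X Y Z x =
     nabla h X (nabla h Y Z) x - nabla h Y (nabla h X Z) x - nabla h (lie_bracket X Y) Z x"

definition coord_field :: "'k \<Rightarrow> real^'k::finite \<Rightarrow> real^'k" where
  "coord_field i x = axis i 1"

text \<open>The order of the arguments realises the convention that the component with indices ijkl is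
  the inner product of R(k,l)j with i.\<close>

definition curv_comp :: "(real^'k::finite \<Rightarrow> real^'k^'k) \<Rightarrow> real^'k \<Rightarrow> 'k \<Rightarrow> 'k \<Rightarrow> 'k \<Rightarrow> 'k \<Rightarrow> real" where
  "curv_comp h x i j k l =
     metric h x (curvature h (coord_field k) (coord_field l) (coord_field j) x) (coord_field i x)"

definition ricci_map :: "(real^'k::finite \<Rightarrow> real^'k^'k) \<Rightarrow> real^'k \<Rightarrow> real^'k^'k" where
  "ricci_map h x = (\<chi> q b. \<Sum>a\<in>UNIV. \<Sum>c\<in>UNIV. \<Sum>d\<in>UNIV.
     matrix_inv (h x) $ a $ c * matrix_inv (h x) $ q $ d * curv_comp h x a b c d)"

definition scalar_curv :: "(real^'k::finite \<Rightarrow> real^'k^'k) \<Rightarrow> real^'k \<Rightarrow> real" where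
  "scalar_curv h x = trace (ricci_map h x)"

text \<open>The Christoffel symbols are the coefficients of the unique torsion-free metric connection.\<close>

lemma christoffel_unique:
  fixes h :: "real^'k::finite \<Rightarrow> real^'k^'k" and \<Gamma> :: "'k \<Rightarrow> 'k \<Rightarrow> 'k \<Rightarrow> real"
  assumes W: "open W" "x \<in> W" "\<And>y. y \<in> W \<Longrightarrow> transpose (h y) = h y"
    and diff: "h differentiable at x" and inv: "invertible (h x)"
  shows "(\<forall>k i j. \<Gamma> k i j = christoffel h k i j x) \<longleftrightarrow>
    (\<forall>k i j. \<Gamma> k i j = \<Gamma> k j i) \<and>
    (\<forall>k i j. partial k (\<lambda>y. h y $ i $ j) x =
       (\<Sum>l\<in>UNIV. \<Gamma> l k i * h x $ l $ j + \<Gamma> l k j * h x $ i $ l))"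
proof -
  define D where "D k i j = partial k (\<lambda>y. h y $ i $ j) x" for k i j
  have hsym: "h y $ i $ j = h y $ j $ i" if "y \<in> W" for y i j
    using W(3)[OF that] by (metis transpose_def vec_lambda_beta)
  have Dsym: "D k i j = D k j i" for k i j
  proof -
    from diff obtain h' where "(h has_derivative h') (at x)"
      unfolding differentiable_def by blast
    then have "((\<lambda>y. h y $ i $ j) has_derivative (\<lambda>v. h' v $ i $ j)) (at x)"
      by (intro bounded_linear.has_derivative[OF bounded_linear_vec_nth])
    then have "(\<lambda>y. h y $ i $ j) differentiable at x"
      unfolding differentiable_def by blast
    then have "frechet_derivative (\<lambda>y. h y $ i $ j) (at x) = frechet_derivative (\<lambda>y. h y $ j $ i) (at x)"
      using hsym W(1,2) by (intro frechet_derivative_transform_within_open) auto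
    then show ?thesis by (simp add: D_def partial_def)
  qed
  define L where "L m i j = (\<Sum>k\<in>UNIV. h x $ m $ k * \<Gamma> k i j)" for m i j
  define E where "E m i j = (D i j m + D j i m - D m i j) / 2" for m i j
  have ch: "christoffel h k i j x = (matrix_inv (h x) *v (\<chi> m. E m i j)) $ k" for k i j
    by (simp add: christoffel_def matrix_vector_mult_def E_def D_def sum_divide_distrib sum_distrib_left)
  have Lv: "(\<chi> m. L m i j) = h x *v (\<chi> k. \<Gamma> k i j)" for i j
    by (simp add: L_def matrix_vector_mult_def vec_eq_iff)
  have inv1: "matrix_inv (h x) ** h x = mat 1" and inv2: "h x ** matrix_inv (h x) = mat 1"
    using someI_ex[OF inv[unfolded invertible_def]] by (simp_all add: matrix_inv_def)
  have A: "(\<forall>k i j. \<Gamma> k i j = christoffel h k i j x) \<longleftrightarrow> (\<forall>m i j. L m i j = E m i j)"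
  proof
    assume "\<forall>k i j. \<Gamma> k i j = christoffel h k i j x"
    then have "(\<chi> k. \<Gamma> k i j) = matrix_inv (h x) *v (\<chi> m. E m i j)" for i j
      by (simp add: vec_eq_iff ch)
    then have "(\<chi> m. L m i j) = (\<chi> m. E m i j)" for i j
      by (simp add: Lv matrix_vector_mul_assoc inv2)
    then show "\<forall>m i j. L m i j = E m i j" by (simp add: vec_eq_iff)
  next
    assume "\<forall>m i j. L m i j = E m i j"
    then have "(\<chi> m. E m i j) = h x *v (\<chi> k. \<Gamma> k i j)" for i j
      by (simp flip: Lv)
    then have "matrix_inv (h x) *v (\<chi> m. E m i j) = (\<chi> k. \<Gamma> k i j)" for i j
      by (simp add: matrix_vector_mul_assoc inv1)
    then show "\<forall>k i j. \<Gamma> k i j = christoffel h k i j x" by (simp add: ch)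
  qed
  have B: "(\<Sum>l\<in>UNIV. \<Gamma> l k i * h x $ l $ j + \<Gamma> l k j * h x $ i $ l) = L j k i + L i k j" for k i j
    by (simp add: L_def sum.distrib hsym[OF W(2), of _ j] mult.commute)
  have C: "(\<forall>k i j. \<Gamma> k i j = \<Gamma> k j i) \<longleftrightarrow> (\<forall>m i j. L m i j = L m j i)"
  proof
    assume "\<forall>m i j. L m i j = L m j i"
    then have "h x *v (\<chi> k. \<Gamma> k i j) = h x *v (\<chi> k. \<Gamma> k j i)" for i j
      by (simp flip: Lv)
    then have "matrix_inv (h x) *v (h x *v (\<chi> k. \<Gamma> k i j)) = matrix_inv (h x) *v (h x *v (\<chi> k. \<Gamma> k j i))" for i j
      by simp
    then have "(\<chi> k. \<Gamma> k i j) = (\<chi> k. \<Gamma> k j i)" for i j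
      by (simp add: matrix_vector_mul_assoc inv1)
    then show "\<forall>k i j. \<Gamma> k i j = \<Gamma> k j i" by (simp add: vec_eq_iff)
  qed (simp add: L_def)
  have "(\<forall>m i j. L m i j = E m i j) \<longleftrightarrow>
      (\<forall>m i j. L m i j = L m j i) \<and> (\<forall>k i j. D k i j = L j k i + L i k j)"
  proof (intro iffI conjI allI)
    fix m i j assume "\<forall>m i j. L m i j = E m i j"
    then show "L m i j = L m j i" "D m i j = L j m i + L i m j"
      using Dsym[of m j i] Dsym[of i m j] Dsym[of j m i]
      by (simp_all only: E_def) (simp_all add: field_simps)
  next
    fix m i j assume H: "(\<forall>m i j. L m i j = L m j i) \<and> (\<forall>k i j. D k i j = L j k i + L i k j)"
    then have "D i j m = L m i j + L j i m" "D j i m = L m j i + L i j m" "D m i j = L j m i + L i m j"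
      "L m j i = L m i j" "L j i m = L j m i" "L i j m = L i m j"
      by blast+
    then show "L m i j = E m i j" by (simp add: E_def)
  qed
  then show ?thesis unfolding A B C by (simp add: D_def)
qed


section \<open>Nambu brackets and the tensors built from them\<close>

text \<open>Below, \<open>ord\<close> enumerates the coordinate indices (as 0, ..., n-1), i.e. it fixes the order of
  the coordinates of the submanifold on which the sign of the Levi-Civita symbol depends.
  Multi-indices are lists. \<open>G\<close> denotes the components of the ambient metric,
  \<open>x\<close> the embedding in coordinates, \<open>\<rho>\<close> the component of the density in the given coordinates (a mere
  function, since the coordinates are fixed), and
  \<open>N\<close> the components of a normal vector field, as a function on the submanifold.\<close>

definition eps :: "(nat \<Rightarrow> 'n::finite) \<Rightarrow> 'n list \<Rightarrow> real" where
  "eps ord as = (if length as = CARD('n) \<and> distinct as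
     then of_int (sign (\<lambda>b. as ! inv_into {..<CARD('n)} ord b)) else 0)"

definition multi_indices :: "nat \<Rightarrow> 'k list set" where
  "multi_indices r = {I. length I = r}"

definition nambu ::
  "(nat \<Rightarrow> 'n::finite) \<Rightarrow> (real^'n \<Rightarrow> real) \<Rightarrow> (real^'n \<Rightarrow> real) list \<Rightarrow> real^'n \<Rightarrow> real" where
  "nambu ord \<rho> fs u = (1 / \<rho> u) *
     (\<Sum>as\<in>multi_indices CARD('n). eps ord as * (\<Prod>r<CARD('n). partial (as ! r) (fs ! r) u))"

definition P_tensor ::
  "(nat \<Rightarrow> 'n::finite) \<Rightarrow> (real^'n \<Rightarrow> real) \<Rightarrow> (real^'n \<Rightarrow> real^'m::finite) \<Rightarrow> real^'n \<Rightarrow> 'm \<Rightarrow> 'm list \<Rightarrow> real" where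
  "P_tensor ord \<rho> x u i J =
     (1 / sqrt (fact (CARD('n) - 1))) * nambu ord \<rho> (map (\<lambda>j v. x v $ j) (i # J)) u"

text \<open>Ambient covariant derivative, in the coordinate direction \<open>a\<close> of the submanifold, of a vector
  field along the submanifold.\<close>

definition nabla_along ::
  "(real^'m::finite \<Rightarrow> real^'m^'m) \<Rightarrow> (real^'n::finite \<Rightarrow> real^'m) \<Rightarrow> 'n \<Rightarrow> (real^'n \<Rightarrow> real^'m) \<Rightarrow> real^'n \<Rightarrow> real^'m" where
  "nabla_along G x a N u = (\<chi> j. partial a (\<lambda>v. N v $ j) u +
     (\<Sum>k\<in>UNIV. \<Sum>l\<in>UNIV. christoffel G j k l (x u) * partial a (\<lambda>v. x v $ k) u * N u $ l))"

definition T_tensor ::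
  "(nat \<Rightarrow> 'n::finite) \<Rightarrow> (real^'n \<Rightarrow> real) \<Rightarrow> (real^'m::finite \<Rightarrow> real^'m^'m) \<Rightarrow> (real^'n \<Rightarrow> real^'m)
     \<Rightarrow> (real^'n \<Rightarrow> real^'m) \<Rightarrow> real^'n \<Rightarrow> 'm list \<Rightarrow> 'm \<Rightarrow> real" where
  "T_tensor ord \<rho> G x N u I j = ((-1) ^ CARD('n) / sqrt (fact (CARD('n) - 1))) *
     (\<Sum>as\<in>multi_indices (CARD('n) - 1). \<Sum>a\<in>UNIV. eps ord (as @ [a]) / \<rho> u *
        (\<Prod>r<CARD('n) - 1. partial (as ! r) (\<lambda>v. x v $ (I ! r)) u) * nabla_along G x a N u $ j)"

definition multi_metric :: "real^'m^'m \<Rightarrow> 'm list \<Rightarrow> 'm list \<Rightarrow> real" where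
  "multi_metric B I J = (\<Prod>r<length I. B $ (I ! r) $ (J ! r))"

definition P_sq ::
  "(nat \<Rightarrow> 'n::finite) \<Rightarrow> (real^'n \<Rightarrow> real) \<Rightarrow> (real^'m::finite \<Rightarrow> real^'m^'m) \<Rightarrow> (real^'n \<Rightarrow> real^'m)
     \<Rightarrow> real^'n \<Rightarrow> real^'m^'m" where
  "P_sq ord \<rho> G x u = (\<chi> i k. \<Sum>I\<in>multi_indices (CARD('n) - 1). \<Sum>J\<in>multi_indices (CARD('n) - 1).
     P_tensor ord \<rho> x u i I * P_tensor ord \<rho> x u k J * multi_metric (G (x u)) I J)"

definition B_tensor ::
  "(nat \<Rightarrow> 'n::finite) \<Rightarrow> (real^'n \<Rightarrow> real) \<Rightarrow> (real^'m::finite \<Rightarrow> real^'m^'m) \<Rightarrow> (real^'n \<Rightarrow> real^'m)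
     \<Rightarrow> (real^'n \<Rightarrow> real^'m) \<Rightarrow> real^'n \<Rightarrow> real^'m^'m" where
  "B_tensor ord \<rho> G x N u = (\<chi> i k. \<Sum>I\<in>multi_indices (CARD('n) - 1). \<Sum>J\<in>multi_indices (CARD('n) - 1).
     P_tensor ord \<rho> x u i I * T_tensor ord \<rho> G x N u J k * multi_metric (G (x u)) I J)"

text \<open>Matrix of the endomorphism of the ambient tangent space obtained by lowering the second
  index.\<close>

definition B_map ::
  "(nat \<Rightarrow> 'n::finite) \<Rightarrow> (real^'n \<Rightarrow> real) \<Rightarrow> (real^'m::finite \<Rightarrow> real^'m^'m) \<Rightarrow> (real^'n \<Rightarrow> real^'m)
     \<Rightarrow> (real^'n \<Rightarrow> real^'m) \<Rightarrow> real^'n \<Rightarrow> real^'m^'m" where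
  "B_map ord \<rho> G x N u = B_tensor ord \<rho> G x N u ** G (x u)"


section \<open>Geometry of the submanifold\<close>

definition induced_metric ::
  "(real^'m::finite \<Rightarrow> real^'m^'m) \<Rightarrow> (real^'n::finite \<Rightarrow> real^'m) \<Rightarrow> real^'n \<Rightarrow> real^'n^'n" where
  "induced_metric G x u = (\<chi> a b. metric G (x u) (partial a x u) (partial b x u))"

definition gamma ::
  "(real^'n::finite \<Rightarrow> real) \<Rightarrow> (real^'m::finite \<Rightarrow> real^'m^'m) \<Rightarrow> (real^'n \<Rightarrow> real^'m) \<Rightarrow> real^'n \<Rightarrow> real" where
  "gamma \<rho> G x u = sqrt (det (induced_metric G x u)) / \<rho> u"

text \<open>The ambient tangent vector whose components in the tangent basis are \<open>\<xi>\<close>.\<close>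

definition tangent_vec :: "(real^'n::finite \<Rightarrow> real^'m::finite) \<Rightarrow> real^'n \<Rightarrow> real^'n \<Rightarrow> real^'m" where
  "tangent_vec x u \<xi> = (\<Sum>a\<in>UNIV. \<xi> $ a *\<^sub>R partial a x u)"

definition normal_frame ::
  "(real^'m::finite \<Rightarrow> real^'m^'m) \<Rightarrow> (real^'n::finite \<Rightarrow> real^'m) \<Rightarrow> ('p::finite \<Rightarrow> real^'n \<Rightarrow> real^'m)
     \<Rightarrow> (real^'n) set \<Rightarrow> bool" where
  "normal_frame G x N W \<longleftrightarrow>
     (\<forall>A. smooth_on (N A) W) \<and>
     (\<forall>u\<in>W. (\<forall>A B. metric G (x u) (N A u) (N B u) = (if A = B then 1 else 0)) \<and>
            (\<forall>A a. metric G (x u) (N A u) (partial a x u) = 0))"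

end

theory Submission
  imports Defs
begin

text \<open>Products of two Levi-Civita symbols contracted with the metric are cofactors of the induced
  metric. Hence \<open>P_sq\<close> is \<open>\<gamma>\<^sup>2\<close> times the orthogonal projection onto the tangent space (with both indices
  raised), and \<open>B_map\<close> is \<open>\<gamma>\<^sup>2\<close> times the Weingarten map composed with that projection. The two formulas
  are therefore contractions of the Gauss equation. The latter follows by commuting covariant
  derivatives along the submanifold: the Christoffel symbols of the induced metric are the tangential
  parts of the derivatives of the coordinate tangent vectors, and the products of the normal parts
  account for the difference of the curvatures.\<close>

section \<open>Partial derivatives\<close>

text \<open>The powers of \<open>gamma\<close> come from normalisation: each contraction of two of
  the Nambu tensors carries the factor \<open>det h / \<rho>^2\<close>, because the
  \<open>(n-1)!\<close> produced by the Levi-Civita symbols cancels the two square roots. Every term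
  of both formulas contains two such contractions, hence the common fourth power. The sign
  \<open>(-1)^n\<close> in \<open>T_tensor\<close> makes up for moving the last index of the symbol
  to the front, except for one overall minus. The curvature of the submanifold contains derivatives
  of Christoffel symbols, and these contain the inverse of the induced metric. Its derivative is
  never computed: the Gauss equation is derived with the upper index lowered, where the symbols are
  inner products of \<open>e m\<close> with \<open>D i (e j)\<close> and metric compatibility gives
  their derivatives. The maps \<open>B_map\<close> factor through the coefficient space of the
  tangent basis, so that cyclicity turns traces over the ambient tangent space into traces of small
  matrices.\<close>

lemma
  assumes "invertible A"
  shows matrix_inv_right: "A ** matrix_inv A = mat 1"
    and matrix_inv_left: "matrix_inv A ** A = mat 1"
  using someI_ex[OF assms[unfolded invertible_def]] by (simp_all add: matrix_inv_def)

lemma partial_has_derivative: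
  "(f has_derivative f') (at u) \<Longrightarrow> partial a f u = f' (axis a 1)"
  by (simp add: partial_def frechet_derivative_at[symmetric])

lemma has_frechet_derivative:
  "f differentiable at u \<Longrightarrow> (f has_derivative frechet_derivative f (at u)) (at u)"
  by (simp add: frechet_derivative_works)

text \<open>\<open>frechet_derivative\<close> is a choice among all derivatives, so it suffices that
  locally equal functions have the same ones, whether or not any exists.\<close>

lemma partial_cong:
  assumes "open W" "u \<in> W" "\<And>v. v \<in> W \<Longrightarrow> f v = g v"
  shows "partial a f u = partial a g u"
proof -
  have "(f has_derivative f') (at u) \<longleftrightarrow> (g has_derivative f') (at u)" for f'
    using assms by (metis has_derivative_transform_within_open)
  then show ?thesis by (simp add: partial_def frechet_derivative_def)
qed

lemma differentiable_cong_open: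
  assumes "open W" "u \<in> W" "\<And>v. v \<in> W \<Longrightarrow> f v = g v"
  shows "f differentiable at u \<longleftrightarrow> g differentiable at u"
  unfolding differentiable_def using assms by (metis has_derivative_transform_within_open)

lemma partial_const [simp]: "partial a (\<lambda>v. k) u = 0"
  by (simp add: partial_def frechet_derivative_const)

lemma partial_add:
  assumes "f differentiable at u" "g differentiable at u"
  shows "partial a (\<lambda>v. f v + g v) u = partial a f u + partial a g u"
  using partial_has_derivative[OF has_derivative_add[OF assms[THEN has_frechet_derivative]]]
  by (simp add: partial_def)

lemma partial_sum:
  assumes "\<And>i. i \<in> I \<Longrightarrow> f i differentiable at u"
  shows "partial a (\<lambda>v. \<Sum>i\<in>I. f i v) u = (\<Sum>i\<in>I. partial a (f i) u)"
proof -
  have "((\<lambda>v. \<Sum>i\<in>I. f i v) has_derivative (\<lambda>v. \<Sum>i\<in>I. frechet_derivative (f i) (at u) v)) (at u)"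
    by (intro has_derivative_sum has_frechet_derivative assms)
  from partial_has_derivative[OF this] show ?thesis by (simp add: partial_def)
qed

lemma partial_mult:
  fixes f g :: "real^'k::finite \<Rightarrow> real"
  assumes "f differentiable at u" "g differentiable at u"
  shows "partial a (\<lambda>v. f v * g v) u = partial a f u * g u + f u * partial a g u"
  using partial_has_derivative[OF has_derivative_mult[OF assms[THEN has_frechet_derivative]], of a]
  by (simp add: partial_def)

lemma differentiable_vec_nth:
  "f differentiable at u \<Longrightarrow> (\<lambda>v. f v $ i) differentiable at u"
  unfolding differentiable_def using bounded_linear.has_derivative[OF bounded_linear_vec_nth] by blast

lemma partial_vec_nth:
  assumes "f differentiable at u"
  shows "partial a (\<lambda>v. f v $ i) u = partial a f u $ i"
  using partial_has_derivative[OF bounded_linear.has_derivative[OF bounded_linear_vec_nth has_frechet_derivative[OF assms]]]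
  by (simp add: partial_def)

lemma frechet_derivative_eq_partial:
  assumes "f differentiable at u"
  shows "frechet_derivative f (at u) w = (\<Sum>a\<in>UNIV. w $ a *\<^sub>R partial a f u)"
proof -
  have lin: "linear (frechet_derivative f (at u))"
    using assms by (simp add: linear_frechet_derivative)
  have "(\<Sum>a\<in>UNIV. w $ a *\<^sub>R axis a 1) = w"
    using basis_expansion[of w] by (simp add: scalar_mult_eq_scaleR)
  then have "frechet_derivative f (at u) w = frechet_derivative f (at u) (\<Sum>a\<in>UNIV. w $ a *\<^sub>R axis a 1)"
    by (rule arg_cong[OF sym])
  also have "\<dots> = (\<Sum>a\<in>UNIV. w $ a *\<^sub>R partial a f u)"
    by (simp add: linear_sum[OF lin] linear_scale[OF lin] partial_def)
  finally show ?thesis .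
qed

lemma partial_compose:
  assumes "x differentiable at u" "f differentiable at (x u)"
  shows "partial a (\<lambda>v. f (x v)) u = (\<Sum>k\<in>UNIV. partial a x u $ k *\<^sub>R partial k f (x u))"
proof -
  have "((\<lambda>v. f (x v)) has_derivative
      (\<lambda>w. frechet_derivative f (at (x u)) (frechet_derivative x (at u) w))) (at u)"
    by (rule has_derivative_compose[OF has_frechet_derivative[OF assms(1)] has_frechet_derivative[OF assms(2)]])
  from partial_has_derivative[OF this, of a] show ?thesis
    by (simp only: frechet_derivative_eq_partial[OF assms(2)] flip: partial_def)
qed

lemma Ck_on_subset: "Ck_on r f S \<Longrightarrow> W \<subseteq> S \<Longrightarrow> Ck_on r f W"
  by (induction r arbitrary: f) (auto intro: continuous_on_subset)

lemma smooth_on_subset: "smooth_on f S \<Longrightarrow> open W \<Longrightarrow> W \<subseteq> S \<Longrightarrow> smooth_on f W"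
  by (auto simp: smooth_on_def intro: Ck_on_subset)

lemma smooth_on_partial: "smooth_on f W \<Longrightarrow> smooth_on (partial a f) W"
  unfolding smooth_on_def by (metis Ck_on.simps(2))

lemma smooth_on_differentiable: "smooth_on f W \<Longrightarrow> u \<in> W \<Longrightarrow> f differentiable at u"
  unfolding smooth_on_def by (metis Ck_on.simps(2))

text \<open>The mean value theorem in direction \<open>a\<close> turns the second difference into an increment of
  the \<open>a\<close>-th partial derivative. As the second difference is symmetric in both directions,
  differentiability of the two first partial derivatives at the point already gives symmetry of the
  mixed derivatives.\<close>

lemma second_difference_estimate:
  fixes f :: "real^'k::finite \<Rightarrow> real"
  assumes W: "open W" "u \<in> W" and f: "\<And>v. v \<in> W \<Longrightarrow> f differentiable at v"
    and fa: "partial a f differentiable at u" and "e > 0"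
  shows "\<exists>r>0. \<forall>t. 0 < t \<and> t < r \<longrightarrow>
    \<bar>f (u + t *\<^sub>R axis a 1 + t *\<^sub>R axis b 1) - f (u + t *\<^sub>R axis a 1) - f (u + t *\<^sub>R axis b 1) + f u
      - t\<^sup>2 * partial b (partial a f) u\<bar> \<le> 3 * e * t\<^sup>2"
proof -
  define L where "L = frechet_derivative (partial a f) (at u)"
  have L: "(partial a f has_derivative L) (at u)" unfolding L_def by (rule has_frechet_derivative[OF fa])
  then have linL: "linear L" by (rule has_derivative_linear)
  have Lb: "L (axis b 1) = partial b (partial a f) u" by (simp add: L_def partial_def)
  from L \<open>e > 0\<close> obtain r1 where r1: "r1 > 0"
    "\<And>y. norm (y - u) < r1 \<Longrightarrow> norm (partial a f y - partial a f u - L (y - u)) \<le> e * norm (y - u)"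
    unfolding has_derivative_at_alt by blast
  from W obtain r2 where r2: "r2 > 0" "ball u r2 \<subseteq> W" by (auto simp: open_contains_ball)
  let ?A = "axis a 1 :: real^'k" let ?B = "axis b 1 :: real^'k"
  \<comment> \<open>The displacement has norm at most the sum of its two step lengths, each below
    \<open>r\<close>; halving keeps it inside both radii.\<close>
  define r where "r = min r1 r2 / 2"
  have small: "norm (s *\<^sub>R ?A + t *\<^sub>R ?B) \<le> s + t" if "0 \<le> s" "0 \<le> t" for s t
    using norm_triangle_ineq[of "s *\<^sub>R ?A" "t *\<^sub>R ?B"] that by (simp add: norm_axis_1)
  show ?thesis
  proof (intro exI[of _ r] conjI allI impI)
    show "r > 0" using r1 r2 by (simp add: r_def)
    fix t assume t: "0 < t \<and> t < r"
    have inW: "u + s *\<^sub>R ?A + q *\<^sub>R ?B \<in> W" if "0 \<le> s" "s \<le> t" "0 \<le> q" "q \<le> t" for s q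
    proof -
      have "norm (s *\<^sub>R ?A + q *\<^sub>R ?B) < r2" using small[of s q] that t by (simp add: r_def min_def split: if_splits)
      then have "u + (s *\<^sub>R ?A + q *\<^sub>R ?B) \<in> ball u r2" by (simp only: mem_ball dist_norm norm_minus_commute[of u]) simp
      then show ?thesis using r2 by (auto simp: add.assoc)
    qed
    \<comment> \<open>The summand \<open>0 *\<^sub>R ?B\<close> keeps both terms in the shape
      treated by \<open>der\<close>, with \<open>q = t\<close> and \<open>q = 0\<close>.\<close>
    define \<phi> where "\<phi> s = f (u + s *\<^sub>R ?A + t *\<^sub>R ?B) - f (u + s *\<^sub>R ?A + 0 *\<^sub>R ?B)" for s
    have der: "((\<lambda>s. f (u + s *\<^sub>R ?A + q *\<^sub>R ?B)) has_real_derivative partial a f (u + s *\<^sub>R ?A + q *\<^sub>R ?B)) (at s)"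
      if "0 \<le> s" "s \<le> t" "0 \<le> q" "q \<le> t" for s q
    proof -
      let ?F = "frechet_derivative f (at (u + s *\<^sub>R ?A + q *\<^sub>R ?B))"
      have F: "(f has_derivative ?F) (at (u + s *\<^sub>R ?A + q *\<^sub>R ?B))"
        by (rule has_frechet_derivative[OF f[OF inW[OF that]]])
      have "((\<lambda>s. u + s *\<^sub>R ?A + q *\<^sub>R ?B) has_derivative (\<lambda>h. h *\<^sub>R ?A)) (at s)"
        by (auto intro!: derivative_eq_intros)
      from has_derivative_compose[OF this F]
      have "((\<lambda>s. f (u + s *\<^sub>R ?A + q *\<^sub>R ?B)) has_derivative (\<lambda>h. ?F (h *\<^sub>R ?A))) (at s)" .
      moreover have "(\<lambda>h. ?F (h *\<^sub>R ?A)) = (*) (partial a f (u + s *\<^sub>R ?A + q *\<^sub>R ?B))"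
        using linear_scale[OF has_derivative_linear[OF F]] by (auto simp: partial_def fun_eq_iff mult.commute)
      ultimately show ?thesis by (simp add: has_field_derivative_def)
    qed
    have "(\<phi> has_real_derivative (partial a f (u + s *\<^sub>R ?A + t *\<^sub>R ?B) - partial a f (u + s *\<^sub>R ?A + 0 *\<^sub>R ?B))) (at s)"
      if "0 \<le> s" "s \<le> t" for s
      unfolding \<phi>_def by (intro DERIV_diff der) (use that t in auto)
    then have "\<exists>z>0. z < t \<and> \<phi> t - \<phi> 0 = (t - 0) *
        (partial a f (u + z *\<^sub>R ?A + t *\<^sub>R ?B) - partial a f (u + z *\<^sub>R ?A + 0 *\<^sub>R ?B))"
      using t by (intro MVT2) blast+
    then obtain z where z: "0 < z" "z < t" and eq: "\<phi> t - \<phi> 0 = t *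
        (partial a f (u + z *\<^sub>R ?A + t *\<^sub>R ?B) - partial a f (u + z *\<^sub>R ?A + 0 *\<^sub>R ?B))" by auto
    \<comment> \<open>First-order expansion of \<open>partial a f\<close> at \<open>u\<close>. In
      the difference of the cases \<open>q = t\<close> and \<open>q = 0\<close> the term
      \<open>z * L ?A\<close> cancels, and \<open>z < t\<close> bounds the two errors by
      \<open>3 * e * t\<close>.\<close>
    have est: "\<bar>partial a f (u + z *\<^sub>R ?A + q *\<^sub>R ?B) - partial a f u - (z * L ?A + q * L ?B)\<bar> \<le> e * (z + q)"
      if "0 \<le> q" "q \<le> t" for q
    proof -
      let ?v = "z *\<^sub>R ?A + q *\<^sub>R ?B"
      have "norm ?v < r1" using small[of z q] that t z by (simp add: r_def min_def split: if_splits)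
      then have "\<bar>partial a f (u + ?v) - partial a f u - L ?v\<bar> \<le> e * norm ?v"
        using r1(2)[of "u + ?v"] by simp
      also have "\<dots> \<le> e * (z + q)" using small[of z q] that z \<open>e > 0\<close> by simp
      also have "L ?v = z * L ?A + q * L ?B" by (simp add: linear_add[OF linL] linear_scale[OF linL])
      finally show ?thesis by (simp only: add.assoc)
    qed
    let ?X = "partial a f (u + z *\<^sub>R ?A + t *\<^sub>R ?B) - partial a f (u + z *\<^sub>R ?A + 0 *\<^sub>R ?B)"
    have "\<bar>?X - t * L ?B\<bar> \<le> e * (z + t) + e * z"
      using est[of t] est[of 0] t by (simp add: abs_le_iff algebra_simps)
    also have "\<dots> \<le> 3 * e * t"
    proof -
      have "e * z \<le> e * t" using z \<open>e > 0\<close> by simp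
      then show ?thesis by (simp add: algebra_simps)
    qed
    finally have "t * \<bar>?X - t * L ?B\<bar> \<le> t * (3 * e * t)" using t by (intro mult_left_mono) auto
    moreover have "t * \<bar>?X - t * L ?B\<bar> = \<bar>(\<phi> t - \<phi> 0) - t\<^sup>2 * L ?B\<bar>"
    proof -
      have "t * \<bar>?X - t * L ?B\<bar> = \<bar>t * (?X - t * L ?B)\<bar>" using t by (simp only: abs_mult) simp
      also have "t * (?X - t * L ?B) = (\<phi> t - \<phi> 0) - t\<^sup>2 * L ?B"
        unfolding eq by (simp add: right_diff_distrib power2_eq_square)
      finally show ?thesis .
    qed
    ultimately show "\<bar>f (u + t *\<^sub>R ?A + t *\<^sub>R ?B) - f (u + t *\<^sub>R ?A) - f (u + t *\<^sub>R ?B) + f u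
      - t\<^sup>2 * partial b (partial a f) u\<bar> \<le> 3 * e * t\<^sup>2"
      by (simp add: \<phi>_def Lb power2_eq_square algebra_simps)
  qed
qed

lemma partial_commute_real:
  fixes f :: "real^'k::finite \<Rightarrow> real"
  assumes W: "open W" "u \<in> W" and f: "\<And>v. v \<in> W \<Longrightarrow> f differentiable at v"
    and fa: "partial a f differentiable at u" and fb: "partial b f differentiable at u"
  shows "partial a (partial b f) u = partial b (partial a f) u"
proof -
  let ?p = "partial a (partial b f) u" and ?q = "partial b (partial a f) u"
  have "\<bar>?p - ?q\<bar> \<le> e" if "e > 0" for e
  proof -
    \<comment> \<open>Two errors of size \<open>3 * (e / 6) * t\<^sup>2\<close> add up to
      \<open>e * t\<^sup>2\<close>.\<close>
    have "e / 6 > 0" using that by simp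
    obtain r1 where r1: "r1 > 0" "\<forall>t. 0 < t \<and> t < r1 \<longrightarrow>
      \<bar>f (u + t *\<^sub>R axis a 1 + t *\<^sub>R axis b 1) - f (u + t *\<^sub>R axis a 1) - f (u + t *\<^sub>R axis b 1) + f u
      - t\<^sup>2 * ?q\<bar> \<le> 3 * (e / 6) * t\<^sup>2"
      using second_difference_estimate[where a=a and b=b, OF W f fa \<open>e / 6 > 0\<close>] by blast
    obtain r2 where r2: "r2 > 0" "\<forall>t. 0 < t \<and> t < r2 \<longrightarrow>
      \<bar>f (u + t *\<^sub>R axis b 1 + t *\<^sub>R axis a 1) - f (u + t *\<^sub>R axis b 1) - f (u + t *\<^sub>R axis a 1) + f u
      - t\<^sup>2 * ?p\<bar> \<le> 3 * (e / 6) * t\<^sup>2"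
      using second_difference_estimate[where a=b and b=a, OF W f fb \<open>e / 6 > 0\<close>] by blast
    define t where "t = min r1 r2 / 2"
    have t: "0 < t" "t < r1" "t < r2" using r1 r2 by (auto simp: t_def)
    define S where "S = f (u + t *\<^sub>R axis a 1 + t *\<^sub>R axis b 1) - f (u + t *\<^sub>R axis a 1) - f (u + t *\<^sub>R axis b 1) + f u"
    have "\<bar>S - t\<^sup>2 * ?q\<bar> \<le> 3 * (e / 6) * t\<^sup>2"
      using r1(2) t unfolding S_def by blast
    moreover have "f (u + t *\<^sub>R axis b 1 + t *\<^sub>R axis a 1) - f (u + t *\<^sub>R axis b 1) - f (u + t *\<^sub>R axis a 1) + f u = S"
      by (simp add: S_def algebra_simps)
    then have "\<bar>S - t\<^sup>2 * ?p\<bar> \<le> 3 * (e / 6) * t\<^sup>2"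
      using r2(2) t by metis
    moreover have "3 * (e / 6) * t\<^sup>2 = e * t\<^sup>2 / 2" by simp
    ultimately have "\<bar>t\<^sup>2 * ?p - t\<^sup>2 * ?q\<bar> \<le> e * t\<^sup>2" by linarith
    then have "t\<^sup>2 * \<bar>?p - ?q\<bar> \<le> t\<^sup>2 * e"
      by (simp add: abs_mult right_diff_distrib[symmetric] mult.commute)
    then show ?thesis using t by simp
  qed
  then have "\<bar>?p - ?q\<bar> \<le> 0" by (rule field_le_epsilon) simp
  then show ?thesis by simp
qed

lemma partial_commute:
  fixes f :: "real^'k::finite \<Rightarrow> real^'m"
  assumes "smooth_on f W" "u \<in> W"
  shows "partial a (partial b f) u = partial b (partial a f) u"
proof (rule vec_eq_iff[THEN iffD2], rule allI)
  fix i
  have W: "open W" using assms by (simp add: smooth_on_def)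
  have d: "f differentiable at v" if "v \<in> W" for v
    using assms that by (auto intro: smooth_on_differentiable)
  have pd: "partial c f differentiable at v" if "v \<in> W" for v c
    using assms that by (auto intro: smooth_on_differentiable smooth_on_partial)
  have eq: "partial c f v $ i = partial c (\<lambda>w. f w $ i) v" if "v \<in> W" for v c
    using d[OF that] by (simp add: partial_vec_nth)
  have pdi: "partial c (\<lambda>w. f w $ i) differentiable at u" for c
    using differentiable_cong_open[where f="\<lambda>v. partial c f v $ i", OF W assms(2) eq]
      differentiable_vec_nth[OF pd[OF assms(2)]] by simp
  have comp: "partial a (partial b f) u $ i = partial a (partial b (\<lambda>w. f w $ i)) u" for a b
  proof -
    have "partial a (partial b f) u $ i = partial a (\<lambda>v. partial b f v $ i) u"
      by (rule partial_vec_nth[OF pd[OF assms(2)], symmetric])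
    also have "\<dots> = partial a (partial b (\<lambda>w. f w $ i)) u"
      by (rule partial_cong[OF W assms(2)]) (rule eq)
    finally show ?thesis .
  qed
  have "partial a (partial b (\<lambda>w. f w $ i)) u = partial b (partial a (\<lambda>w. f w $ i)) u"
    by (rule partial_commute_real[OF W assms(2) _ pdi pdi]) (rule differentiable_vec_nth[OF d])
  then show "partial a (partial b f) u $ i = partial b (partial a f) u $ i"
    by (simp only: comp)
qed

section \<open>Contractions of Levi-Civita symbols\<close>

lemma finite_multi_indices [simp]: "finite (multi_indices r :: 'k::finite list set)"
  using finite_lists_length_eq[of "UNIV :: 'k set" r] by (simp add: multi_indices_def)

lemma sum_multi_indices_Suc:
  "(\<Sum>I\<in>multi_indices (Suc r). F I) = (\<Sum>a\<in>UNIV. \<Sum>I\<in>multi_indices r. F (a # I))"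
  for F :: "'k::finite list \<Rightarrow> real"
proof -
  have "(multi_indices (Suc r) :: 'k list set) = (\<lambda>(a, I). a # I) ` (UNIV \<times> multi_indices r)"
    by (auto simp: multi_indices_def length_Suc_conv image_iff)
  moreover have "inj_on (\<lambda>(a, I). a # I) (UNIV \<times> multi_indices r :: ('k \<times> 'k list) set)"
    by (auto simp: inj_on_def)
  ultimately show ?thesis
    by (simp add: sum.reindex sum.cartesian_product case_prod_unfold comp_def)
qed

lemma sum_multi_indices_prod:
  fixes f :: "nat \<Rightarrow> 'k::finite \<Rightarrow> real"
  shows "(\<Sum>I\<in>multi_indices r. \<Prod>s<r. f s (I ! s)) = (\<Prod>s<r. \<Sum>k\<in>UNIV. f s k)"
proof (induction r arbitrary: f)
  case 0
  then show ?case by (simp add: multi_indices_def)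
next
  case (Suc r)
  show ?case
    unfolding sum_multi_indices_Suc prod.lessThan_Suc_shift
    by (simp add: Suc.IH[of "\<lambda>s. f (Suc s)"] sum_distrib_left[symmetric] sum_distrib_right[symmetric])
qed

text \<open>The multi-index metric is a product over the slots, so after expanding both sums each
  slot is contracted independently. With \<open>p\<close> and \<open>q\<close> the tangent basis,
  every slot yields a component of the induced metric. The coefficients stay arbitrary so that the
  same identity serves both \<open>P_sq\<close> and \<open>B_tensor\<close>.\<close>

lemma multi_metric_contraction:
  fixes p q :: "'n::finite \<Rightarrow> 'm::finite \<Rightarrow> real" and B :: "real^'m^'m"
  shows "(\<Sum>I\<in>multi_indices r. \<Sum>J\<in>multi_indices r.
      (\<Sum>as\<in>multi_indices r. \<alpha> as * (\<Prod>s<r. p (as ! s) (I ! s))) *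
      (\<Sum>bs\<in>multi_indices r. \<beta> bs * (\<Prod>s<r. q (bs ! s) (J ! s))) * multi_metric B I J) =
    (\<Sum>as\<in>multi_indices r. \<Sum>bs\<in>multi_indices r. \<alpha> as * \<beta> bs *
      (\<Prod>s<r. \<Sum>k\<in>UNIV. \<Sum>l\<in>UNIV. p (as ! s) k * q (bs ! s) l * B $ k $ l))"
proof -
  let ?M = "multi_indices r :: 'm list set" and ?N = "multi_indices r :: 'n list set"
  have inner: "(\<Sum>I\<in>?M. \<Sum>J\<in>?M. \<Prod>s<r. p (as ! s) (I ! s) * q (bs ! s) (J ! s) * B $ (I ! s) $ (J ! s))
      = (\<Prod>s<r. \<Sum>k\<in>UNIV. \<Sum>l\<in>UNIV. p (as ! s) k * q (bs ! s) l * B $ k $ l)" for as bs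
    using sum_multi_indices_prod[where f = "\<lambda>s l. p (as ! s) (I ! s) * q (bs ! s) l * B $ (I ! s) $ l" and r = r for I]
      sum_multi_indices_prod[where f = "\<lambda>s k. \<Sum>l\<in>UNIV. p (as ! s) k * q (bs ! s) l * B $ k $ l" and r = r]
    by simp
  have "(\<Sum>I\<in>?M. \<Sum>J\<in>?M. (\<Sum>as\<in>?N. \<alpha> as * (\<Prod>s<r. p (as ! s) (I ! s))) *
      (\<Sum>bs\<in>?N. \<beta> bs * (\<Prod>s<r. q (bs ! s) (J ! s))) * multi_metric B I J) =
     (\<Sum>I\<in>?M. \<Sum>J\<in>?M. \<Sum>as\<in>?N. \<Sum>bs\<in>?N. \<alpha> as * \<beta> bs *
       (\<Prod>s<r. p (as ! s) (I ! s) * q (bs ! s) (J ! s) * B $ (I ! s) $ (J ! s)))"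
  proof (intro sum.cong refl)
    fix I J assume "I \<in> ?M"
    then have "multi_metric B I J = (\<Prod>s<r. B $ (I ! s) $ (J ! s))"
      by (simp add: multi_metric_def multi_indices_def)
    then show "(\<Sum>as\<in>?N. \<alpha> as * (\<Prod>s<r. p (as ! s) (I ! s))) *
      (\<Sum>bs\<in>?N. \<beta> bs * (\<Prod>s<r. q (bs ! s) (J ! s))) * multi_metric B I J =
      (\<Sum>as\<in>?N. \<Sum>bs\<in>?N. \<alpha> as * \<beta> bs *
       (\<Prod>s<r. p (as ! s) (I ! s) * q (bs ! s) (J ! s) * B $ (I ! s) $ (J ! s)))"
      by (simp add: sum_product) (simp add: sum_distrib_left prod.distrib mult_ac)
  qed
  also have "\<dots> = (\<Sum>as\<in>?N. \<Sum>bs\<in>?N. \<Sum>I\<in>?M. \<Sum>J\<in>?M. \<alpha> as * \<beta> bs *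
       (\<Prod>s<r. p (as ! s) (I ! s) * q (bs ! s) (J ! s) * B $ (I ! s) $ (J ! s)))"
  proof -
    have swap: "(\<Sum>I\<in>A. \<Sum>J\<in>B. \<Sum>a\<in>C. \<Sum>b\<in>D. g I J a b) = (\<Sum>a\<in>C. \<Sum>b\<in>D. \<Sum>I\<in>A. \<Sum>J\<in>B. g I J a b)"
      for g :: "'m list \<Rightarrow> 'm list \<Rightarrow> 'n list \<Rightarrow> 'n list \<Rightarrow> real" and A B C D
    proof -
      have "(\<Sum>I\<in>A. \<Sum>J\<in>B. \<Sum>a\<in>C. \<Sum>b\<in>D. g I J a b) = (\<Sum>I\<in>A. \<Sum>a\<in>C. \<Sum>b\<in>D. \<Sum>J\<in>B. g I J a b)"
        by (rule sum.cong[OF refl], subst sum.swap, rule sum.cong[OF refl], rule sum.swap)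
      also have "\<dots> = (\<Sum>a\<in>C. \<Sum>b\<in>D. \<Sum>I\<in>A. \<Sum>J\<in>B. g I J a b)"
        by (subst sum.swap, rule sum.cong[OF refl], rule sum.swap)
      finally show ?thesis .
    qed
    show ?thesis by (rule swap)
  qed
  finally show ?thesis by (simp add: sum_distrib_left[symmetric] inner)
qed

context
  fixes ord :: "nat \<Rightarrow> 'n::finite"
  assumes ord: "bij_betw ord {..<CARD('n)} UNIV"
begin

abbreviation (input) position :: "'n \<Rightarrow> nat" where "position \<equiv> inv_into {..<CARD('n)} ord"

lemma ord_position: "ord (position b) = b"
  using bij_betw_inv_into_right[OF ord] by simp

lemma position_less: "position b < CARD('n)"
  using bij_betw_inv_into[OF ord] by (auto simp: bij_betw_def)

lemma position_ord: "r < CARD('n) \<Longrightarrow> position (ord r) = r"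
  using bij_betw_inv_into_left[OF ord] by simp

text \<open>Composition with \<open>position\<close> turns a list of indices into a self-map of the
  index type; this is the permutation whose sign \<open>eps\<close> takes.\<close>

lemma nth_position_permutes:
  assumes "length as = CARD('n)" "distinct as"
  shows "(\<lambda>b. as ! position b) permutes UNIV"
proof -
  have "inj (\<lambda>b. as ! position b)"
    using assms position_less by (auto simp: inj_def nth_eq_iff_index_eq) (metis ord_position)
  then show ?thesis
    by (intro bij_imp_permutes) (simp_all add: bij_def finite_UNIV_inj_surj)
qed

text \<open>This is the Leibniz formula. Permutations \<open>p\<close> correspond to the lists
  \<open>map (p \<circ> ord) [0..<CARD('n)]\<close>, which are all the duplicate-free lists of full
  length, and \<open>eps\<close> vanishes on the remaining ones.\<close>

lemma sum_eps_det:
  fixes A :: "real^'n^'n"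
  shows "(\<Sum>as\<in>multi_indices CARD('n). eps ord as * (\<Prod>r<CARD('n). A $ ord r $ (as ! r))) = det A"
proof -
  let ?l = "\<lambda>p. map (p \<circ> ord) [0..<CARD('n)]"
  let ?P = "{p. p permutes (UNIV :: 'n set)}"
  have nth: "?l p ! position b = p b" for p b using position_less by (simp add: ord_position)
  have inj: "inj_on ?l ?P"
    by (rule inj_onI) (metis nth ext)
  have dist: "distinct (?l p)" if "p permutes UNIV" for p
  proof -
    have "inj_on ord {..<CARD('n)}" using ord by (simp add: bij_betw_def)
    moreover have "inj p" using that by (simp add: permutes_inj)
    ultimately have "inj_on (p \<circ> ord) {..<CARD('n)}" by (simp add: comp_inj_on inj_on_subset)
    then show ?thesis by (simp add: distinct_map atLeast0LessThan)
  qed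
  have image: "?l ` ?P = {as \<in> multi_indices CARD('n). distinct as}"
  proof (intro subset_antisym subsetI)
    fix as :: "'n list" assume "as \<in> {as \<in> multi_indices CARD('n). distinct as}"
    then have as: "length as = CARD('n)" "distinct as" by (auto simp: multi_indices_def)
    have "as = ?l (\<lambda>b. as ! position b)" using as by (intro nth_equalityI) (simp_all add: position_ord)
    then show "as \<in> ?l ` ?P" using nth_position_permutes[OF as] by blast
  qed (use dist in \<open>auto simp: multi_indices_def\<close>)
  have "(\<Sum>as\<in>multi_indices CARD('n). eps ord as * (\<Prod>r<CARD('n). A $ ord r $ (as ! r)))
      = (\<Sum>as\<in>?l ` ?P. eps ord as * (\<Prod>r<CARD('n). A $ ord r $ (as ! r)))"
    unfolding image by (rule sum.mono_neutral_right) (auto simp: eps_def)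
  also have "\<dots> = (\<Sum>p\<in>?P. eps ord (?l p) * (\<Prod>r<CARD('n). A $ ord r $ (?l p ! r)))"
    by (simp add: sum.reindex[OF inj])
  also have "\<dots> = (\<Sum>p\<in>?P. of_int (sign p) * (\<Prod>i\<in>UNIV. A $ i $ p i))"
  proof (rule sum.cong[OF refl])
    fix p assume "p \<in> ?P"
    have "(\<lambda>b. ?l p ! position b) = p" by (simp only: nth)
    then have "eps ord (?l p) = of_int (sign p)"
      using dist \<open>p \<in> ?P\<close> unfolding eps_def by simp
    moreover have "(\<Prod>r<CARD('n). A $ ord r $ (?l p ! r)) = (\<Prod>r<CARD('n). A $ ord r $ p (ord r))"
      by (intro prod.cong) simp_all
    ultimately show "eps ord (?l p) * (\<Prod>r<CARD('n). A $ ord r $ (?l p ! r)) = of_int (sign p) * (\<Prod>i\<in>UNIV. A $ i $ p i)"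
      by (simp add: prod.reindex_bij_betw[OF ord, of "\<lambda>i. A $ i $ p i"])
  qed
  finally show ?thesis by (simp add: det_def)
qed

text \<open>The left side is the determinant of the matrix whose rows are selected by
  \<open>cs\<close>: a permutation of the rows contributes its sign, and a repeated entry of
  \<open>cs\<close> gives two equal rows.\<close>

lemma sum_eps_rows:
  fixes h :: "real^'n^'n"
  assumes "length cs = CARD('n)"
  shows "(\<Sum>as\<in>multi_indices CARD('n). eps ord as * (\<Prod>r<CARD('n). h $ (cs ! r) $ (as ! r))) = eps ord cs * det h"
proof -
  let ?A = "\<chi> i. h $ (cs ! position i)"
  have "(\<Sum>as\<in>multi_indices CARD('n). eps ord as * (\<Prod>r<CARD('n). h $ (cs ! r) $ (as ! r))) = det ?A"
    unfolding sum_eps_det[symmetric] by (intro sum.cong refl) (simp add: position_ord)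
  also have "\<dots> = eps ord cs * det h"
  proof (cases "distinct cs")
    case True
    then show ?thesis
      using det_permute_rows[OF nth_position_permutes[OF assms True], of h] assms by (simp add: eps_def)
  next
    case False
    then obtain r s where rs: "r < CARD('n)" "s < CARD('n)" "r \<noteq> s" "cs ! r = cs ! s"
      using assms by (auto simp: distinct_conv_nth)
    then have "ord r \<noteq> ord s" by (metis position_ord)
    moreover have "row (ord r) ?A = row (ord s) ?A" using rs by (simp add: row_def position_ord)
    ultimately have "det ?A = 0" by (rule det_identical_rows)
    then show ?thesis using False by (simp add: eps_def)
  qed
  finally show ?thesis .
qed

text \<open>For \<open>b = c\<close> each nonzero term is the square of a sign, one for every
  arrangement of the other indices. For \<open>b \<noteq> c\<close> a nonzero term is impossible:
  \<open>b # J\<close> would exhaust all indices, so \<open>c\<close> would already occur in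
  \<open>J\<close>.\<close>

lemma sum_eps_Cons_mult:
  "(\<Sum>J\<in>multi_indices (CARD('n) - 1). eps ord (b # J) * eps ord (c # J)) = (if b = c then fact (CARD('n) - 1) else 0)"
proof (cases "b = c")
  case True
  let ?D = "{J. length J = CARD('n) - 1 \<and> distinct J \<and> set J \<subseteq> UNIV - {c}}"
  have card_pos: "0 < CARD('n)" by simp
  have "(\<Sum>J\<in>multi_indices (CARD('n) - 1). eps ord (b # J) * eps ord (c # J)) = (\<Sum>J\<in>?D. 1)"
  proof (rule sum.mono_neutral_cong_right)
    show "\<forall>J\<in>multi_indices (CARD('n) - 1) - ?D. eps ord (b # J) * eps ord (c # J) = 0"
      by (auto simp: eps_def multi_indices_def)
    show "eps ord (b # J) * eps ord (c # J) = 1" if "J \<in> ?D" for J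
    proof -
      have "length (c # J) = CARD('n)" "distinct (c # J)" using that card_pos by auto
      then show ?thesis using True unfolding eps_def by (simp only: if_True simp_thms of_int_mult[symmetric] sign_idempotent of_int_1)
    qed
  qed (simp, auto simp: multi_indices_def)
  also have "\<dots> = fact (CARD('n) - 1)"
    using card_lists_distinct_length_eq[of "UNIV - {c}" "CARD('n) - 1"] by (simp add: card_Diff_singleton fact_prod)
  finally show ?thesis using True by simp
next
  case False
  have "eps ord (b # J) * eps ord (c # J) = 0" if "J \<in> multi_indices (CARD('n) - 1)" for J
  proof (rule ccontr)
    assume "eps ord (b # J) * eps ord (c # J) \<noteq> 0"
    then have d: "distinct (b # J)" "distinct (c # J)" "length (b # J) = CARD('n)"
      by (auto simp: eps_def split: if_splits)
    then have "card (set (b # J)) = CARD('n)" by (metis distinct_card)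
    then have "set (b # J) = UNIV" by (metis card_eq_UNIV_imp_eq_UNIV finite)
    then show False using d False by auto
  qed
  then show ?thesis using False by (auto intro!: sum.neutral)
qed

text \<open>Exchanging neighbouring entries precomposes the associated permutation with the
  transposition of the two indices at those places in the order \<open>ord\<close>.\<close>

lemma eps_swap: "eps ord (xs @ p # q # ys) = - eps ord (xs @ q # p # ys)"
proof (cases "length (xs @ q # p # ys) = CARD('n) \<and> distinct (xs @ q # p # ys)")
  case True
  let ?f = "\<lambda>b. (xs @ q # p # ys) ! position b" and ?k = "length xs"
  let ?t = "Transposition.transpose (ord ?k) (ord (Suc ?k))"
  have perm: "?f permutes UNIV" using nth_position_permutes True by blast
  have k: "Suc ?k < CARD('n)" using True by auto
  then have neq: "ord ?k \<noteq> ord (Suc ?k)" using position_ord by (metis Suc_lessD n_not_Suc_n)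
  have "(\<lambda>b. (xs @ p # q # ys) ! position b) = ?f \<circ> ?t"
  proof
    fix b
    consider "b = ord ?k" | "b = ord (Suc ?k)" | "b \<noteq> ord ?k" "b \<noteq> ord (Suc ?k)" by blast
    then show "(xs @ p # q # ys) ! position b = (?f \<circ> ?t) b"
    proof cases
      case 3
      then have "position b \<noteq> ?k" "position b \<noteq> Suc ?k" by (metis ord_position)+
      then show ?thesis using 3 by (auto simp: nth_append nth_Cons split: nat.split)
    qed (use k in \<open>auto simp: position_ord nth_append\<close>)
  qed
  moreover have "sign (?f \<circ> ?t) = sign ?f * sign ?t"
    using perm by (intro sign_compose permutation_swap_id) (auto simp: permutation_permutes)
  ultimately have "sign (\<lambda>b. (xs @ p # q # ys) ! position b) = - sign ?f"
    using neq by (simp add: sign_swap_id)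
  then show ?thesis using True by (auto simp: eps_def)
qed (auto simp: eps_def)

text \<open>The entry \<open>a\<close> passes each element of \<open>ys\<close> by one adjacent
  swap. This aligns \<open>T_tensor\<close>, where the differentiation index stands last, with
  \<open>P_tensor\<close>, where the free index stands first.\<close>

lemma eps_rotate: "eps ord (xs @ ys @ [a]) = (-1) ^ length ys * eps ord (xs @ a # ys)"
proof (induction ys arbitrary: xs)
  case (Cons y ys)
  show ?case using Cons.IH[of "xs @ [y]"] eps_swap[of xs a y ys] by simp
qed simp

text \<open>Contracting the double sum with a row of \<open>h\<close> produces a full determinant expansion, which
  is orthogonal to the remaining symbol; so the double sum is a multiple of the inverse of \<open>h\<close>.\<close>

lemma sum_eps_cofactor:
  fixes h :: "real^'n^'n"
  assumes "invertible h"
  shows "(\<Sum>I\<in>multi_indices (CARD('n) - 1). \<Sum>J\<in>multi_indices (CARD('n) - 1).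
      eps ord (a # I) * eps ord (b # J) * (\<Prod>r<CARD('n) - 1. h $ (I ! r) $ (J ! r)))
    = fact (CARD('n) - 1) * det h * matrix_inv h $ b $ a"
proof -
  let ?M = "multi_indices (CARD('n) - 1) :: 'n list set"
  define K where "K a b = (\<Sum>I\<in>?M. \<Sum>J\<in>?M. eps ord (a # I) * eps ord (b # J) * (\<Prod>r<CARD('n) - 1. h $ (I ! r) $ (J ! r)))" for a b
  have n: "CARD('n) = Suc (CARD('n) - 1)" by simp
  have contr: "(\<Sum>c\<in>UNIV. K c b * h $ c $ d) = (if b = d then fact (CARD('n) - 1) * det h else 0)" for b d
  proof -
    \<comment> \<open>The sum over \<open>c # I\<close> runs through all lists of full length and
      selects the columns \<open>d # J\<close> of \<open>h\<close>; since
      \<open>sum_eps_rows\<close> selects rows, it is applied to the transpose.\<close>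
    have row: "(\<Sum>c\<in>UNIV. \<Sum>I\<in>?M. eps ord (c # I) * (h $ c $ d * (\<Prod>r<CARD('n) - 1. h $ (I ! r) $ (J ! r))))
      = eps ord (d # J) * det h" if "J \<in> ?M" for J
    proof -
      have "length (d # J) = CARD('n)" using that n by (simp add: multi_indices_def)
      from sum_eps_rows[OF this, of "Finite_Cartesian_Product.transpose h"] show ?thesis
        by (subst (asm) n, unfold sum_multi_indices_Suc, subst (asm) n, unfold prod.lessThan_Suc_shift)
          (simp only: det_transpose, simp add: Finite_Cartesian_Product.transpose_def)
    qed
    have "(\<Sum>c\<in>UNIV. K c b * h $ c $ d) = (\<Sum>c\<in>UNIV. \<Sum>I\<in>?M. \<Sum>J\<in>?M. eps ord (b # J) *
        (eps ord (c # I) * (h $ c $ d * (\<Prod>r<CARD('n) - 1. h $ (I ! r) $ (J ! r)))))"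
      unfolding K_def sum_distrib_right by (simp add: mult_ac)
    also have "\<dots> = (\<Sum>c\<in>UNIV. \<Sum>J\<in>?M. \<Sum>I\<in>?M. eps ord (b # J) *
        (eps ord (c # I) * (h $ c $ d * (\<Prod>r<CARD('n) - 1. h $ (I ! r) $ (J ! r)))))"
      by (intro sum.cong refl sum.swap)
    also have "\<dots> = (\<Sum>J\<in>?M. \<Sum>c\<in>UNIV. \<Sum>I\<in>?M. eps ord (b # J) *
        (eps ord (c # I) * (h $ c $ d * (\<Prod>r<CARD('n) - 1. h $ (I ! r) $ (J ! r)))))"
      by (rule sum.swap)
    also have "\<dots> = (\<Sum>J\<in>?M. eps ord (b # J) * (eps ord (d # J) * det h))"
      by (intro sum.cong refl) (simp only: row sum_distrib_left[symmetric])
    also have "\<dots> = (\<Sum>J\<in>?M. eps ord (b # J) * eps ord (d # J)) * det h"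
      by (simp add: sum_distrib_left mult_ac)
    finally show ?thesis by (simp only: sum_eps_Cons_mult) simp
  qed
  \<comment> \<open>With the indices of \<open>K\<close> exchanged, \<open>contr\<close> reads as a
    matrix product with \<open>h\<close> on the right, so that multiplying by the inverse isolates
    \<open>?K\<close>.\<close>
  let ?K = "\<chi> b a. K a b"
  have "?K ** h = (fact (CARD('n) - 1) * det h) *\<^sub>R mat 1"
    by (simp add: matrix_matrix_mult_def vec_eq_iff contr mat_def)
  then have "?K ** (h ** matrix_inv h) = ((fact (CARD('n) - 1) * det h) *\<^sub>R mat 1) ** matrix_inv h"
    by (simp add: matrix_mul_assoc)
  then have "?K = (fact (CARD('n) - 1) * det h) *\<^sub>R matrix_inv h"
    using matrix_inv_right[OF assms] by (simp add: scalar_matrix_assoc[symmetric])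
  then have "?K $ b $ a = ((fact (CARD('n) - 1) * det h) *\<^sub>R matrix_inv h) $ b $ a" by simp
  then show ?thesis by (simp add: K_def)
qed

end

section \<open>Christoffel symbols and curvature in coordinates\<close>

lemma differentiable_vecI:
  fixes f :: "real^'k::finite \<Rightarrow> ('b::euclidean_space)^'m::finite"
  assumes "\<And>i. (\<lambda>v. f v $ i) differentiable at u"
  shows "f differentiable at u"
proof -
  have "(\<lambda>v. f v \<bullet> axis i b) differentiable at u" for i b
    using differentiable_inner[OF assms[of i] differentiable_const[of b]] by (simp add: inner_axis)
  then show ?thesis
    by (subst differentiable_componentwise_within) (auto simp: Basis_vec_def)
qed

lemma differentiable_prod:
  fixes f :: "'i \<Rightarrow> 'a::real_normed_vector \<Rightarrow> real"
  assumes "\<And>i. i \<in> I \<Longrightarrow> f i differentiable (at u)"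
  shows "(\<lambda>v. \<Prod>i\<in>I. f i v) differentiable (at u)"
  using assms by (induction I rule: infinite_finite_induct) (auto intro: differentiable_mult)

lemma differentiable_det:
  fixes f :: "real^'k::finite \<Rightarrow> real^'n^'n::finite"
  assumes "\<And>i j. (\<lambda>v. f v $ i $ j) differentiable at u"
  shows "(\<lambda>v. det (f v)) differentiable at u"
  unfolding det_def by (intro differentiable_sum ballI differentiable_mult differentiable_const differentiable_prod assms) simp

text \<open>Cramer's rule for the equation solved by column \<open>j\<close> of the inverse. It
  exhibits the entries as quotients of polynomials in the entries of \<open>A\<close>, which is what
  makes them visibly differentiable.\<close>

lemma matrix_inv_nth:
  fixes A :: "real^'n^'n::finite"
  assumes "invertible A"
  shows "matrix_inv A $ i $ j = det (\<chi> k l. if l = i then axis j 1 $ k else A $ k $ l) / det A"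
proof -
  have "A *v (matrix_inv A *v axis j 1) = axis j 1"
    using matrix_inv_right[OF assms] by (simp add: matrix_vector_mul_assoc)
  then have "(matrix_inv A *v axis j 1) $ i = (\<chi> k. det (\<chi> i l. if l = k then axis j 1 $ i else A $ i $ l) / det A) $ i"
    using cramer[of A "matrix_inv A *v axis j 1" "axis j 1"] assms by (simp add: invertible_det_nz)
  moreover have "(matrix_inv A *v axis j 1) $ i = matrix_inv A $ i $ j"
    by (simp add: matrix_vector_mult_def axis_def if_distrib cong: if_cong)
  ultimately show ?thesis by simp
qed

text \<open>The quotient from Cramer's rule represents the inverse wherever the matrix is
  invertible; assuming this on an open set makes the two functions agree near
  \<open>u\<close>.\<close>

lemma differentiable_matrix_inv:
  fixes f :: "real^'k::finite \<Rightarrow> real^'n^'n::finite"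
  assumes W: "open W" "u \<in> W" "\<And>v. v \<in> W \<Longrightarrow> invertible (f v)"
    and f: "f differentiable at u"
  shows "(\<lambda>v. matrix_inv (f v) $ i $ j) differentiable at u"
proof -
  have fij: "(\<lambda>v. f v $ k $ l) differentiable at u" for k l
    using f by (intro differentiable_vec_nth)
  have "det (f u) \<noteq> 0" using W by (simp add: invertible_det_nz)
  moreover have "(\<lambda>v. det (\<chi> k l. if l = i then axis j 1 $ k else f v $ k $ l)) differentiable at u"
  proof (rule differentiable_det)
    show "(\<lambda>v. (\<chi> k l. if l = i then axis j 1 $ k else f v $ k $ l) $ p $ q) differentiable at u" for p q
      by (cases "q = i") (simp_all add: fij)
  qed
  ultimately have "(\<lambda>v. det (\<chi> k l. if l = i then axis j 1 $ k else f v $ k $ l) / det (f v)) differentiable at u"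
    by (intro differentiable_divide[OF _ differentiable_det[OF fij]])
  then show ?thesis
    using differentiable_cong_open[OF W(1,2), of "\<lambda>v. matrix_inv (f v) $ i $ j"] matrix_inv_nth[OF W(3)] by simp
qed

section \<open>Algebra of the metric, and curvature in coordinate fields\<close>

lemma metric_inner: "metric h x v w = v \<bullet> (h x *v w)"
  by (simp add: metric_def inner_vec_def matrix_vector_mult_def sum_distrib_left mult_ac)

lemma metric_commute:
  assumes "transpose (h x) = h x"
  shows "metric h x v w = metric h x w v"
  using assms by (metis metric_inner dot_lmul_matrix inner_commute transpose_matrix_vector)

lemma metric_linear:
  "metric h x (v + v') w = metric h x v w + metric h x v' w"
  "metric h x v (w + w') = metric h x v w + metric h x v w'"
  "metric h x (v - v') w = metric h x v w - metric h x v' w"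
  "metric h x v (w - w') = metric h x v w - metric h x v w'"
  "metric h x (r *\<^sub>R v) w = r * metric h x v w"
  "metric h x v (r *\<^sub>R w) = r * metric h x v w"
  "metric h x (\<Sum>i\<in>I. f i) w = (\<Sum>i\<in>I. metric h x (f i) w)"
  "metric h x v (\<Sum>i\<in>I. f i) = (\<Sum>i\<in>I. metric h x v (f i))"
  "metric h x 0 w = 0" "metric h x v 0 = 0"
  by (simp_all add: metric_inner inner_simps matrix_vector_right_distrib inner_sum_left
      matrix_vector_mult_diff_distrib scaleR_matrix_vector_assoc[symmetric] matrix_vector_mult_scaleR
      linear_sum[OF matrix_vector_mul_linear] inner_sum_right)

lemma sum_axis: "(\<Sum>i\<in>UNIV. axis c 1 $ i * F i) = F c"
  for F :: "'k::finite \<Rightarrow> real"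
  by (simp add: axis_def if_distrib[where f = "\<lambda>t. t * _"] cong: if_cong)

lemma nabla_coord_field: "nabla h (coord_field c) V y $ k =
    partial c (\<lambda>y. V y $ k) y + (\<Sum>j\<in>UNIV. christoffel h k c j y * V y $ j)"
proof -
  have "(\<Sum>i\<in>UNIV. \<Sum>j\<in>UNIV. christoffel h k i j y * axis c 1 $ i * V y $ j) =
      (\<Sum>i\<in>UNIV. axis c 1 $ i * (\<Sum>j\<in>UNIV. christoffel h k i j y * V y $ j))"
    by (simp add: sum_distrib_left mult_ac)
  then show ?thesis by (simp add: nabla_def coord_field_def sum_axis)
qed

lemma nabla_coord_fields: "nabla h (coord_field d) (coord_field b) y $ k = christoffel h k d b y"
  by (simp add: nabla_coord_field) (simp add: coord_field_def axis_def if_distrib cong: if_cong)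

lemma curvature_coord_fields:
  "curvature h (coord_field c) (coord_field d) (coord_field b) u $ f =
    partial c (christoffel h f d b) u - partial d (christoffel h f c b) u +
    (\<Sum>e\<in>UNIV. christoffel h f c e u * christoffel h e d b u) -
    (\<Sum>e\<in>UNIV. christoffel h f d e u * christoffel h e c b u)"
proof -
  have "lie_bracket (coord_field c) (coord_field d) u = 0"
    by (simp add: lie_bracket_def vec_eq_iff coord_field_def)
  then have "nabla h (lie_bracket (coord_field c) (coord_field d)) (coord_field b) u $ f = 0"
    by (simp add: nabla_def)
  then show ?thesis
    by (simp add: curvature_def nabla_coord_field[of h _ "nabla _ _ _"] nabla_coord_fields)
qed

lemma curv_comp_sum: "curv_comp h u i j k l =
    (\<Sum>f\<in>UNIV. h u $ f $ i * curvature h (coord_field k) (coord_field l) (coord_field j) u $ f)"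
  by (simp add: curv_comp_def metric_def coord_field_def axis_def if_distrib cong: if_cong)

context
  fixes h :: "real^'k::finite \<Rightarrow> real^'k^'k" and W :: "(real^'k) set"
  assumes W: "open W" and sym: "\<And>y. y \<in> W \<Longrightarrow> transpose (h y) = h y"
    and inv: "\<And>y. y \<in> W \<Longrightarrow> invertible (h y)" and diff: "\<And>y. y \<in> W \<Longrightarrow> h differentiable at y"
begin

text \<open>Inserting the Christoffel symbols themselves as the candidate into the uniqueness
  statement yields their symmetry here and metric compatibility in
  \<open>partial_metric\<close>.\<close>

lemma christoffel_commute: "y \<in> W \<Longrightarrow> christoffel h k i j y = christoffel h k j i y"
  using christoffel_unique[OF W _ sym diff inv, of y "\<lambda>k i j. christoffel h k i j y"] by blast

lemma partial_metric: "y \<in> W \<Longrightarrow> partial k (\<lambda>y. h y $ i $ j) y =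
    (\<Sum>l\<in>UNIV. christoffel h l k i y * h y $ l $ j + christoffel h l k j y * h y $ i $ l)"
  using christoffel_unique[OF W _ sym diff inv, of y "\<lambda>k i j. christoffel h k i j y"] by blast

text \<open>Differentiating \<open>L\<close> as the product of \<open>h\<close> with the Christoffel
  symbols and using metric compatibility for the derivative of \<open>h\<close> produces two
  quadratic sums; one of them is the quadratic term of the curvature, the other is the correction
  that remains. In this form only the lowered symbols are differentiated.\<close>

lemma curv_comp_lowered:
  assumes u: "u \<in> W"
    and L: "\<And>v m i j. v \<in> W \<Longrightarrow> L m i j v = (\<Sum>k\<in>UNIV. h v $ m $ k * christoffel h k i j v)"
    and dch: "\<And>k i j. christoffel h k i j differentiable at u"
  shows "curv_comp h u a b c d = partial c (L a d b) u - partial d (L a c b) u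
    - (\<Sum>f\<in>UNIV. L f c a u * christoffel h f d b u) + (\<Sum>f\<in>UNIV. L f d a u * christoffel h f c b u)"
proof -
  have dh: "(\<lambda>v. h v $ i $ j) differentiable at u" for i j
    using diff[OF u] by (intro differentiable_vec_nth)
  have hs: "h u $ i $ j = h u $ j $ i" for i j
    using sym[OF u] by (metis transpose_def vec_lambda_beta)
  have half: "(\<Sum>f\<in>UNIV. h u $ f $ a * (partial c (christoffel h f d b) u + (\<Sum>e\<in>UNIV. christoffel h f c e u * christoffel h e d b u)))
     = partial c (L a d b) u - (\<Sum>f\<in>UNIV. L f c a u * christoffel h f d b u)" for c d
  proof -
    have "partial c (L a d b) u = partial c (\<lambda>v. \<Sum>k\<in>UNIV. h v $ a $ k * christoffel h k d b v) u"
      by (rule partial_cong[OF W u]) (rule L)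
    also have "\<dots> = (\<Sum>k\<in>UNIV. partial c (\<lambda>v. h v $ a $ k) u * christoffel h k d b u + h u $ a $ k * partial c (christoffel h k d b) u)"
      by (simp add: partial_sum partial_mult dh dch)
    also have "\<dots> = (\<Sum>k\<in>UNIV. (L k c a u + L a c k u) * christoffel h k d b u + h u $ a $ k * partial c (christoffel h k d b) u)"
      by (simp add: partial_metric[OF u] L[OF u] sum.distrib hs mult.commute)
    finally have 1: "partial c (L a d b) u = (\<Sum>k\<in>UNIV. L k c a u * christoffel h k d b u) + (\<Sum>k\<in>UNIV. L a c k u * christoffel h k d b u)
        + (\<Sum>k\<in>UNIV. h u $ a $ k * partial c (christoffel h k d b) u)"
      by (simp add: sum.distrib algebra_simps)
    have "(\<Sum>f\<in>UNIV. h u $ f $ a * (\<Sum>e\<in>UNIV. christoffel h f c e u * christoffel h e d b u))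
      = (\<Sum>f\<in>UNIV. \<Sum>e\<in>UNIV. h u $ a $ f * (christoffel h f c e u * christoffel h e d b u))"
      by (simp add: sum_distrib_left hs)
    also have "\<dots> = (\<Sum>e\<in>UNIV. \<Sum>f\<in>UNIV. h u $ a $ f * (christoffel h f c e u * christoffel h e d b u))"
      by (rule sum.swap)
    also have "\<dots> = (\<Sum>e\<in>UNIV. L a c e u * christoffel h e d b u)"
      by (simp add: L[OF u] sum_distrib_right mult.assoc)
    finally show ?thesis using 1 by (simp add: distrib_left sum.distrib hs)
  qed
  have "curv_comp h u a b c d =
     (\<Sum>f\<in>UNIV. h u $ f $ a * (partial c (christoffel h f d b) u + (\<Sum>e\<in>UNIV. christoffel h f c e u * christoffel h e d b u)))
     - (\<Sum>f\<in>UNIV. h u $ f $ a * (partial d (christoffel h f c b) u + (\<Sum>e\<in>UNIV. christoffel h f d e u * christoffel h e c b u)))"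
    unfolding curv_comp_sum curvature_coord_fields sum_subtractf[symmetric]
    by (intro sum.cong refl) (simp add: algebra_simps)
  then show ?thesis by (simp add: half)
qed

end

lemma christoffel_differentiable:
  fixes h :: "real^'k::finite \<Rightarrow> real^'k^'k"
  assumes h: "smooth_on h W" and inv: "\<And>y. y \<in> W \<Longrightarrow> invertible (h y)" and y: "y \<in> W"
  shows "christoffel h k i j differentiable at y"
proof -
  have W: "open W" using h by (simp add: smooth_on_def)
  have p: "partial k (\<lambda>y. h y $ i $ j) differentiable at y" for k i j
  proof -
    have d: "h differentiable at v" if "v \<in> W" for v
      using h that by (rule smooth_on_differentiable)
    have "partial k (\<lambda>y. h y $ i $ j) v = partial k h v $ i $ j" if "v \<in> W" for v
      using partial_vec_nth[OF differentiable_vec_nth[OF d[OF that]]] partial_vec_nth[OF d[OF that]] by simp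
    moreover have "(\<lambda>v. partial k h v $ i $ j) differentiable at y"
      by (intro differentiable_vec_nth smooth_on_differentiable[OF smooth_on_partial[OF h] y])
    ultimately show ?thesis
      using differentiable_cong_open[OF W y, of "partial k (\<lambda>y. h y $ i $ j)" "\<lambda>v. partial k h v $ i $ j"] by blast
  qed
  note mi = differentiable_matrix_inv[OF W y inv smooth_on_differentiable[OF h y]]
  have "(\<lambda>y. matrix_inv (h y) $ k $ l * (partial i (\<lambda>y. h y $ j $ l) y + partial j (\<lambda>y. h y $ i $ l) y
      - partial l (\<lambda>y. h y $ i $ j) y)) differentiable at y" for l
    using differentiable_mult[OF mi differentiable_diff[OF differentiable_add[OF p p] p]] .
  then have "(\<lambda>y. (1/2) * (\<Sum>l\<in>UNIV. matrix_inv (h y) $ k $ l * (partial i (\<lambda>y. h y $ j $ l) y + partial j (\<lambda>y. h y $ i $ l) y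
      - partial l (\<lambda>y. h y $ i $ j) y))) differentiable at y"
    by (intro differentiable_mult[OF differentiable_const] differentiable_sum) auto
  then show ?thesis by (simp add: christoffel_def[abs_def])
qed

text \<open>Dimension count: the map sending coefficients to the combination of tangent and normal
  vectors is injective, hence onto.\<close>

lemma normal_decomposition:
  fixes G :: "real^'m::finite \<Rightarrow> real^'m^'m" and e :: "'n::finite \<Rightarrow> real^'m" and N :: "'p::finite \<Rightarrow> real^'m"
  assumes card: "CARD('m) = CARD('n) + CARD('p)" and sym: "transpose (G y) = G y"
    and H: "invertible H" "\<And>a b. H $ a $ b = metric G y (e a) (e b)"
    and NN: "\<And>A B. metric G y (N A) (N B) = (if A = B then 1 else 0)"
    and Ne: "\<And>A a. metric G y (N A) (e a) = 0"
  shows "metric G y V Z = (\<Sum>a\<in>UNIV. \<Sum>b\<in>UNIV. matrix_inv H $ a $ b * metric G y (e b) V * metric G y (e a) Z)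
     + (\<Sum>A\<in>UNIV. metric G y (N A) V * metric G y (N A) Z)"
proof -
  note comm = metric_commute[of G y, OF sym]
  define T where "T = (\<lambda>(\<xi>::real^'n, \<eta>::real^'p). (\<Sum>a\<in>UNIV. \<xi> $ a *\<^sub>R e a) + (\<Sum>A\<in>UNIV. \<eta> $ A *\<^sub>R N A))"
  have linT: "linear T"
    by (rule linearI) (auto simp: T_def scaleR_add_left sum.distrib scaleR_sum_right scaleR_add_right)
  \<comment> \<open>Pairing with the tangent and normal vectors recovers the coefficients, the
    tangential ones up to the Gram matrix \<open>H\<close>. This proves injectivity and later
    identifies the coefficients of \<open>V\<close>.\<close>
  have Te: "metric G y (e b) (T (\<xi>, \<eta>)) = (H *v \<xi>) $ b" for b \<xi> \<eta>
    using Ne by (simp add: T_def metric_linear comm[of _ "N _"] matrix_vector_mult_def H mult.commute)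
  have TN: "metric G y (N A) (T (\<xi>, \<eta>)) = \<eta> $ A" for A \<xi> \<eta>
    using Ne by (simp add: T_def metric_linear NN if_distrib[where f = "\<lambda>t. _ * t"] cong: if_cong)
  have injT: "inj T"
  proof (subst linear_injective_0[OF linT], intro allI impI)
    fix q assume "T q = 0"
    obtain \<xi> \<eta> where q: "q = (\<xi>, \<eta>)" by (cases q)
    have "(H *v \<xi>) $ b = 0" "\<eta> $ A = 0" for b A
      using Te[of b \<xi> \<eta>] TN[of A \<xi> \<eta>] \<open>T q = 0\<close> by (simp_all add: q metric_linear)
    then have "H *v \<xi> = 0" "\<eta> = 0" by (simp_all add: vec_eq_iff)
    moreover have "matrix_inv H *v (H *v \<xi>) = \<xi>"
      using matrix_inv_left[OF H(1)] by (simp add: matrix_vector_mul_assoc)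
    ultimately show "q = 0" by (simp add: q zero_prod_def)
  qed
  have "dim (range T) = DIM((real^'n) \<times> (real^'p))"
    using dim_image_eq[OF linT, of UNIV] injT by simp
  then have "dim (range T) = DIM(real^'m)" using card by simp
  then have "surj T" using linear_subspace_image[OF linT subspace_UNIV]
    by (metis dim_eq_full span_eq_iff)
  obtain \<xi> \<eta> where V: "V = T (\<xi>, \<eta>)" using \<open>surj T\<close> by (metis surj_def prod.exhaust)
  have \<xi>: "\<xi> = matrix_inv H *v (\<chi> b. metric G y (e b) V)"
    using matrix_inv_left[OF H(1)] by (simp add: V Te matrix_vector_mul_assoc vec_lambda_eta)
  have "metric G y V Z = (\<Sum>a\<in>UNIV. \<xi> $ a * metric G y (e a) Z) + (\<Sum>A\<in>UNIV. metric G y (N A) V * metric G y (N A) Z)"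
    unfolding V TN by (simp add: T_def metric_linear)
  also have "(\<Sum>a\<in>UNIV. \<xi> $ a * metric G y (e a) Z)
     = (\<Sum>a\<in>UNIV. \<Sum>b\<in>UNIV. matrix_inv H $ a $ b * metric G y (e b) V * metric G y (e a) Z)"
    by (subst \<xi>) (simp add: matrix_vector_mult_def sum_distrib_right)
  finally show ?thesis .
qed

section \<open>The Gauss equation\<close>

text \<open>The coordinate picture of one pair of charts, with the manifolds stripped off:
  \<open>W\<close> is a coordinate domain of the submanifold and \<open>U\<close> one of the ambient
  space. Positivity of the metric appears only through its consequences, invertibility of
  \<open>G\<close> and of the induced metric.\<close>

locale submanifold_patch =
  fixes G :: "real^'m::finite \<Rightarrow> real^'m^'m" and x :: "real^'n::finite \<Rightarrow> real^'m"
    and U :: "(real^'m) set" and W :: "(real^'n) set"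
  assumes smooth_G: "smooth_on G U" and smooth_x: "smooth_on x W"
    and x_in: "v \<in> W \<Longrightarrow> x v \<in> U"
    and G_sym: "y \<in> U \<Longrightarrow> transpose (G y) = G y"
    and G_inv: "y \<in> U \<Longrightarrow> invertible (G y)"
    and h_inv: "v \<in> W \<Longrightarrow> invertible (induced_metric G x v)"
begin

abbreviation e :: "'n \<Rightarrow> real^'n \<Rightarrow> real^'m" where "e a \<equiv> partial a x"
abbreviation D :: "'n \<Rightarrow> (real^'n \<Rightarrow> real^'m) \<Rightarrow> real^'n \<Rightarrow> real^'m" where "D \<equiv> nabla_along G x"
abbreviation gm :: "real^'n \<Rightarrow> real^'m \<Rightarrow> real^'m \<Rightarrow> real" where "gm v \<equiv> metric G (x v)"

text \<open>For fixed \<open>a\<close> this is the matrix of the connection pulled back along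
  \<open>x\<close>, in the coordinate frame of the ambient space: \<open>D a\<close> is the partial
  derivative plus this matrix.\<close>

definition connection_coeff :: "'n \<Rightarrow> 'm \<Rightarrow> 'm \<Rightarrow> real^'n \<Rightarrow> real" where
  "connection_coeff a f l v = (\<Sum>k\<in>UNIV. christoffel G f k l (x v) * e a v $ k)"

lemma open_U: "open U" and open_W: "open W"
  using smooth_G smooth_x by (auto simp: smooth_on_def)

lemma G_diff: "y \<in> U \<Longrightarrow> G differentiable at y"
  using smooth_G by (rule smooth_on_differentiable)

lemma x_diff: "v \<in> W \<Longrightarrow> x differentiable at v"
  using smooth_x by (rule smooth_on_differentiable)

lemma e_smooth: "smooth_on (e a) W"
  using smooth_x by (rule smooth_on_partial)

lemma e_diff: "v \<in> W \<Longrightarrow> e a differentiable at v"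
  using e_smooth by (rule smooth_on_differentiable)

lemma G_christoffel_commute: "y \<in> U \<Longrightarrow> christoffel G k i j y = christoffel G k j i y"
  by (rule christoffel_commute[OF open_U G_sym G_inv G_diff])

lemma partial_G: "y \<in> U \<Longrightarrow> partial k (\<lambda>y. G y $ i $ j) y =
    (\<Sum>l\<in>UNIV. christoffel G l k i y * G y $ l $ j + christoffel G l k j y * G y $ i $ l)"
  by (rule partial_metric[OF open_U G_sym G_inv G_diff])

lemma gm_commute: "v \<in> W \<Longrightarrow> gm v V Z = gm v Z V"
  by (intro metric_commute G_sym x_in)

lemma christoffel_x_diff: "v \<in> W \<Longrightarrow> (\<lambda>v. christoffel G f k l (x v)) differentiable at v"
  by (intro differentiable_compose[OF christoffel_differentiable[OF smooth_G G_inv x_in] x_diff])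

lemma connection_coeff_diff: "v \<in> W \<Longrightarrow> connection_coeff a f l differentiable at v"
  unfolding connection_coeff_def[abs_def]
  by (intro differentiable_sum ballI differentiable_mult christoffel_x_diff differentiable_vec_nth e_diff) simp

lemma D_nth:
  assumes "v \<in> W" "V differentiable at v"
  shows "D a V v $ f = partial a V v $ f + (\<Sum>l\<in>UNIV. connection_coeff a f l v * V v $ l)"
proof -
  have "(\<Sum>k\<in>UNIV. \<Sum>l\<in>UNIV. christoffel G f k l (x v) * partial a (\<lambda>v. x v $ k) v * V v $ l) =
      (\<Sum>l\<in>UNIV. \<Sum>k\<in>UNIV. christoffel G f k l (x v) * e a v $ k * V v $ l)"
    using x_diff[OF assms(1)] by (simp add: partial_vec_nth) (rule sum.swap)
  then show ?thesis
    using assms by (simp add: nabla_along_def partial_vec_nth connection_coeff_def sum_distrib_right)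
qed

text \<open>Torsion-freeness along the submanifold, from the symmetric Christoffel symbols and the
  commuting second derivatives of \<open>x\<close>. The symmetry of the second fundamental form and
  of the induced Christoffel symbols both rest on it.\<close>

lemma D_e_commute:
  assumes v: "v \<in> W" shows "D a (e b) v = D b (e a) v"
proof (rule vec_eq_iff[THEN iffD2], rule allI)
  fix f
  have "(\<Sum>l\<in>UNIV. connection_coeff a f l v * e b v $ l) = (\<Sum>l\<in>UNIV. \<Sum>k\<in>UNIV. christoffel G f k l (x v) * e a v $ k * e b v $ l)"
    by (simp add: connection_coeff_def sum_distrib_right)
  also have "\<dots> = (\<Sum>k\<in>UNIV. \<Sum>l\<in>UNIV. christoffel G f k l (x v) * e a v $ k * e b v $ l)"
    by (rule sum.swap)
  also have "\<dots> = (\<Sum>k\<in>UNIV. connection_coeff b f k v * e a v $ k)"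
    using G_christoffel_commute[OF x_in[OF v]]
    by (simp add: connection_coeff_def sum_distrib_right) (simp add: mult_ac)
  finally show "D a (e b) v $ f = D b (e a) v $ f"
    by (simp add: D_nth[OF v e_diff[OF v]] partial_commute[OF smooth_x v, of a b])
qed

lemma partial_G_x:
  assumes v: "v \<in> W"
  shows "partial a (\<lambda>v. G (x v) $ i $ j) v = (\<Sum>l\<in>UNIV. connection_coeff a l i v * G (x v) $ l $ j + connection_coeff a l j v * G (x v) $ i $ l)"
proof -
  have "partial a (\<lambda>v. G (x v) $ i $ j) v = (\<Sum>k\<in>UNIV. e a v $ k * partial k (\<lambda>y. G y $ i $ j) (x v))"
    using partial_compose[OF x_diff[OF v], of "\<lambda>y. G y $ i $ j" a] G_diff[OF x_in[OF v]]
    by (simp add: differentiable_vec_nth)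
  also have "\<dots> = (\<Sum>k\<in>UNIV. \<Sum>l\<in>UNIV. e a v $ k * (christoffel G l k i (x v) * G (x v) $ l $ j + christoffel G l k j (x v) * G (x v) $ i $ l))"
    by (simp add: partial_G[OF x_in[OF v]] sum_distrib_left)
  also have "\<dots> = (\<Sum>l\<in>UNIV. \<Sum>k\<in>UNIV. e a v $ k * (christoffel G l k i (x v) * G (x v) $ l $ j + christoffel G l k j (x v) * G (x v) $ i $ l))"
    by (rule sum.swap)
  also have "\<dots> = (\<Sum>l\<in>UNIV. connection_coeff a l i v * G (x v) $ l $ j + connection_coeff a l j v * G (x v) $ i $ l)"
    by (simp add: connection_coeff_def sum_distrib_left sum.distrib distrib_left mult_ac)
  finally show ?thesis .
qed

text \<open>The product rule leaves the derivative of \<open>G\<close> along \<open>x\<close>. By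
  ambient metric compatibility it consists of two connection terms, which become those of
  \<open>D a V\<close> and \<open>D a Z\<close> once the upper index \<open>l\<close> is renamed to
  the index contracted with the metric.\<close>

lemma
  assumes v: "v \<in> W" and V: "V differentiable at v" and Z: "Z differentiable at v"
  shows gm_diff: "(\<lambda>v. gm v (V v) (Z v)) differentiable at v"
    and partial_gm: "partial a (\<lambda>v. gm v (V v) (Z v)) v = gm v (D a V v) (Z v) + gm v (V v) (D a Z v)"
proof -
  have Gij: "(\<lambda>v. G (x v) $ i $ j) differentiable at v" for i j
    using differentiable_compose[OF G_diff[OF x_in[OF v]] x_diff[OF v]] by (intro differentiable_vec_nth)
  have Vi: "(\<lambda>v. V v $ i) differentiable at v" and Zi: "(\<lambda>v. Z v $ i) differentiable at v" for i
    using V Z by (simp_all add: differentiable_vec_nth)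
  show "(\<lambda>v. gm v (V v) (Z v)) differentiable at v"
    unfolding metric_def by (intro differentiable_sum ballI differentiable_mult Gij Vi Zi) simp_all
  have "partial a (\<lambda>v. gm v (V v) (Z v)) v = (\<Sum>i\<in>UNIV. \<Sum>j\<in>UNIV.
      partial a (\<lambda>v. G (x v) $ i $ j) v * V v $ i * Z v $ j + G (x v) $ i $ j * partial a V v $ i * Z v $ j
      + G (x v) $ i $ j * V v $ i * partial a Z v $ j)"
    unfolding metric_def
    by (simp add: partial_sum partial_mult partial_vec_nth Gij Vi Zi V Z distrib_right)
  also have "\<dots> = (\<Sum>i\<in>UNIV. \<Sum>j\<in>UNIV. \<Sum>l\<in>UNIV. connection_coeff a l i v * G (x v) $ l $ j * V v $ i * Z v $ j)
      + (\<Sum>i\<in>UNIV. \<Sum>j\<in>UNIV. \<Sum>l\<in>UNIV. connection_coeff a l j v * G (x v) $ i $ l * V v $ i * Z v $ j)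
      + (\<Sum>i\<in>UNIV. \<Sum>j\<in>UNIV. G (x v) $ i $ j * partial a V v $ i * Z v $ j)
      + (\<Sum>i\<in>UNIV. \<Sum>j\<in>UNIV. G (x v) $ i $ j * V v $ i * partial a Z v $ j)"
    by (simp add: partial_G_x[OF v] sum.distrib sum_distrib_right distrib_right)
  also have "(\<Sum>i\<in>UNIV. \<Sum>j\<in>UNIV. \<Sum>l\<in>UNIV. connection_coeff a l i v * G (x v) $ l $ j * V v $ i * Z v $ j)
      = (\<Sum>l\<in>UNIV. \<Sum>j\<in>UNIV. \<Sum>i\<in>UNIV. connection_coeff a l i v * G (x v) $ l $ j * V v $ i * Z v $ j)"
    by (subst sum.swap, subst (2) sum.swap, rule sum.swap)
  also have "(\<Sum>i\<in>UNIV. \<Sum>j\<in>UNIV. \<Sum>l\<in>UNIV. connection_coeff a l j v * G (x v) $ i $ l * V v $ i * Z v $ j)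
      = (\<Sum>i\<in>UNIV. \<Sum>l\<in>UNIV. \<Sum>j\<in>UNIV. connection_coeff a l j v * G (x v) $ i $ l * V v $ i * Z v $ j)"
    by (rule sum.cong[OF refl], rule sum.swap)
  finally show "partial a (\<lambda>v. gm v (V v) (Z v)) v = gm v (D a V v) (Z v) + gm v (V v) (D a Z v)"
    by (simp add: metric_def D_nth[OF v] V Z sum.distrib distrib_left distrib_right sum_distrib_left sum_distrib_right mult_ac)
qed

lemma D_e_diff:
  assumes v: "v \<in> W" shows "D a (e b) differentiable at v"
proof (rule differentiable_vecI)
  fix f
  have "(\<lambda>v. partial a (e b) v $ f + (\<Sum>l\<in>UNIV. connection_coeff a f l v * e b v $ l)) differentiable at v"
    by (intro differentiable_add differentiable_sum ballI differentiable_mult differentiable_vec_nth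
        connection_coeff_diff[OF v] e_diff[OF v] smooth_on_differentiable[OF smooth_on_partial[OF e_smooth] v]) simp
  then show "(\<lambda>v. D a (e b) v $ f) differentiable at v"
    using differentiable_cong_open[OF open_W v, of "\<lambda>v. D a (e b) v $ f"
        "\<lambda>v. partial a (e b) v $ f + (\<Sum>l\<in>UNIV. connection_coeff a f l v * e b v $ l)"] D_nth[OF _ e_diff] by blast
qed

lemma partial_connection_coeff:
  assumes v: "v \<in> W"
  shows "partial c (connection_coeff d f l) v = (\<Sum>k\<in>UNIV. \<Sum>i\<in>UNIV. partial i (christoffel G f k l) (x v) * e c v $ i * e d v $ k)
    + (\<Sum>k\<in>UNIV. christoffel G f k l (x v) * partial c (e d) v $ k)"
proof -
  have "partial c (\<lambda>v. christoffel G f k l (x v)) v = (\<Sum>i\<in>UNIV. e c v $ i * partial i (christoffel G f k l) (x v))" for k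
    using partial_compose[OF x_diff[OF v] christoffel_differentiable[OF smooth_G G_inv x_in[OF v]]] by simp
  then have "partial c (\<lambda>v. \<Sum>k\<in>UNIV. christoffel G f k l (x v) * e d v $ k) v =
     (\<Sum>k\<in>UNIV. (\<Sum>i\<in>UNIV. e c v $ i * partial i (christoffel G f k l) (x v)) * e d v $ k + christoffel G f k l (x v) * partial c (e d) v $ k)"
    using e_diff[OF v] by (simp add: partial_sum partial_mult christoffel_x_diff[OF v] differentiable_vec_nth partial_vec_nth)
  then show ?thesis
    by (simp add: connection_coeff_def[abs_def] sum.distrib sum_distrib_left mult_ac)
qed

text \<open>The terms are grouped by their behaviour under exchange of \<open>c\<close> and
  \<open>d\<close>: the second derivative of \<open>e b\<close> is symmetric, and so is the sum of
  the two mixed terms. Only the derivative of the connection matrix and the product of two such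
  matrices survive in the commutator.\<close>

lemma D_D_e_nth:
  assumes v: "v \<in> W"
  shows "D c (D d (e b)) v $ f = partial c (partial d (e b)) v $ f
    + (\<Sum>l\<in>UNIV. partial c (connection_coeff d f l) v * e b v $ l)
    + (\<Sum>l\<in>UNIV. connection_coeff d f l v * partial c (e b) v $ l) + (\<Sum>l\<in>UNIV. connection_coeff c f l v * partial d (e b) v $ l)
    + (\<Sum>j\<in>UNIV. (\<Sum>l\<in>UNIV. connection_coeff c f l v * connection_coeff d l j v) * e b v $ j)"
proof -
  have "partial c (D d (e b)) v $ f = partial c (\<lambda>v. D d (e b) v $ f) v"
    by (rule partial_vec_nth[OF D_e_diff[OF v], symmetric])
  also have "\<dots> = partial c (\<lambda>v. partial d (e b) v $ f + (\<Sum>l\<in>UNIV. connection_coeff d f l v * e b v $ l)) v"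
    by (rule partial_cong[OF open_W v]) (rule D_nth[OF _ e_diff])
  also have "\<dots> = partial c (partial d (e b)) v $ f + (\<Sum>l\<in>UNIV. partial c (connection_coeff d f l) v * e b v $ l + connection_coeff d f l v * partial c (e b) v $ l)"
    using smooth_on_differentiable[OF smooth_on_partial[OF e_smooth] v]
    by (simp add: partial_add partial_sum partial_mult connection_coeff_diff[OF v] e_diff[OF v] differentiable_vec_nth partial_vec_nth)
  finally have 1: "partial c (D d (e b)) v $ f = partial c (partial d (e b)) v $ f + (\<Sum>l\<in>UNIV. partial c (connection_coeff d f l) v * e b v $ l + connection_coeff d f l v * partial c (e b) v $ l)" .
  have "(\<Sum>l\<in>UNIV. connection_coeff c f l v * (\<Sum>j\<in>UNIV. connection_coeff d l j v * e b v $ j)) = (\<Sum>l\<in>UNIV. \<Sum>j\<in>UNIV. connection_coeff c f l v * connection_coeff d l j v * e b v $ j)"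
    by (simp add: sum_distrib_left mult_ac)
  also have "\<dots> = (\<Sum>j\<in>UNIV. (\<Sum>l\<in>UNIV. connection_coeff c f l v * connection_coeff d l j v) * e b v $ j)"
    by (subst sum.swap) (simp add: sum_distrib_right)
  finally show ?thesis
    by (simp add: D_nth[OF v D_e_diff[OF v]] 1 D_nth[OF v e_diff[OF v]] sum.distrib distrib_left)
qed

lemma sum_connection_coeff_mult:
  "(\<Sum>l\<in>UNIV. connection_coeff c f l v * connection_coeff d l j v) =
    (\<Sum>k\<in>UNIV. \<Sum>l\<in>UNIV. (\<Sum>q\<in>UNIV. christoffel G f k q (x v) * christoffel G q l j (x v)) * e c v $ k * e d v $ l)"
proof -
  have "(\<Sum>q\<in>UNIV. connection_coeff c f q v * connection_coeff d q j v) = (\<Sum>q\<in>UNIV. \<Sum>k\<in>UNIV. \<Sum>l\<in>UNIV. christoffel G f k q (x v) * christoffel G q l j (x v) * e c v $ k * e d v $ l)"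
    by (simp add: connection_coeff_def sum_product mult_ac)
  also have "\<dots> = (\<Sum>k\<in>UNIV. \<Sum>l\<in>UNIV. \<Sum>q\<in>UNIV. christoffel G f k q (x v) * christoffel G q l j (x v) * e c v $ k * e d v $ l)"
    by (subst sum.swap, rule sum.cong[OF refl], rule sum.swap)
  finally show ?thesis by (simp add: sum_distrib_right)
qed

text \<open>The curvature of a pulled-back connection is the pullback of the curvature. The Lie
  bracket term is absent because the coordinate directions commute; correspondingly the second
  derivatives of \<open>x\<close> cancel by \<open>pe\<close>.\<close>

lemma D_commutator:
  assumes v: "v \<in> W"
  shows "D c (D d (e b)) v $ f - D d (D c (e b)) v $ f =
    (\<Sum>j\<in>UNIV. \<Sum>k\<in>UNIV. \<Sum>l\<in>UNIV. curvature G (coord_field k) (coord_field l) (coord_field j) (x v) $ f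
      * e c v $ k * e d v $ l * e b v $ j)"
proof -
  have pp: "partial c (partial d (e b)) v = partial d (partial c (e b)) v"
    by (rule partial_commute[OF e_smooth v])
  have pe: "partial c (e d) v = partial d (e c) v"
    by (rule partial_commute[OF smooth_x v])
  have "D c (D d (e b)) v $ f - D d (D c (e b)) v $ f =
    (\<Sum>j\<in>UNIV. (partial c (connection_coeff d f j) v - partial d (connection_coeff c f j) v + (\<Sum>l\<in>UNIV. connection_coeff c f l v * connection_coeff d l j v)
      - (\<Sum>l\<in>UNIV. connection_coeff d f l v * connection_coeff c l j v)) * e b v $ j)"
    by (simp add: D_D_e_nth[OF v] pp sum.distrib sum_subtractf distrib_right left_diff_distrib)
  also have "\<dots> = (\<Sum>j\<in>UNIV. (\<Sum>k\<in>UNIV. \<Sum>l\<in>UNIV. curvature G (coord_field k) (coord_field l) (coord_field j) (x v) $ f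
      * e c v $ k * e d v $ l) * e b v $ j)"
  proof (rule sum.cong[OF refl])
    fix j
    \<comment> \<open>Summation indices are renamed in \<open>dc\<close>, \<open>dd\<close> and
      \<open>cd\<close> so that \<open>k\<close> always contracts with \<open>e c\<close> and
      \<open>l\<close> with \<open>e d\<close>, matching the curvature term by term.\<close>
    have dc: "partial c (connection_coeff d f j) v = (\<Sum>k\<in>UNIV. \<Sum>l\<in>UNIV. partial k (christoffel G f l j) (x v) * e c v $ k * e d v $ l)
      + (\<Sum>k\<in>UNIV. christoffel G f k j (x v) * partial c (e d) v $ k)"
      unfolding partial_connection_coeff[OF v] by (subst sum.swap) simp
    have dd: "partial d (connection_coeff c f j) v = (\<Sum>k\<in>UNIV. \<Sum>l\<in>UNIV. partial l (christoffel G f k j) (x v) * e c v $ k * e d v $ l)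
      + (\<Sum>k\<in>UNIV. christoffel G f k j (x v) * partial c (e d) v $ k)"
      unfolding partial_connection_coeff[OF v] pe by (simp add: mult_ac)
    have cd: "(\<Sum>q\<in>UNIV. connection_coeff d f q v * connection_coeff c q j v) =
      (\<Sum>k\<in>UNIV. \<Sum>l\<in>UNIV. (\<Sum>q\<in>UNIV. christoffel G f l q (x v) * christoffel G q k j (x v)) * e c v $ k * e d v $ l)"
      unfolding sum_connection_coeff_mult by (subst sum.swap) (simp add: mult_ac)
    have "partial c (connection_coeff d f j) v - partial d (connection_coeff c f j) v + (\<Sum>l\<in>UNIV. connection_coeff c f l v * connection_coeff d l j v)
      - (\<Sum>l\<in>UNIV. connection_coeff d f l v * connection_coeff c l j v) = (\<Sum>k\<in>UNIV. \<Sum>l\<in>UNIV. curvature G (coord_field k) (coord_field l) (coord_field j) (x v) $ f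
      * e c v $ k * e d v $ l)"
      unfolding dc dd cd sum_connection_coeff_mult curvature_coord_fields
      by (simp add: sum.distrib sum_subtractf distrib_right left_diff_distrib)
    then show "(partial c (connection_coeff d f j) v - partial d (connection_coeff c f j) v + (\<Sum>l\<in>UNIV. connection_coeff c f l v * connection_coeff d l j v)
      - (\<Sum>l\<in>UNIV. connection_coeff d f l v * connection_coeff c l j v)) * e b v $ j = (\<Sum>k\<in>UNIV. \<Sum>l\<in>UNIV. curvature G (coord_field k) (coord_field l) (coord_field j) (x v) $ f
      * e c v $ k * e d v $ l) * e b v $ j" by simp
  qed
  finally show ?thesis by (simp add: sum_distrib_right)
qed

definition ambient_curv :: "real^'n \<Rightarrow> 'n \<Rightarrow> 'n \<Rightarrow> 'n \<Rightarrow> 'n \<Rightarrow> real" where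
  "ambient_curv v a b c d = (\<Sum>i\<in>UNIV. \<Sum>j\<in>UNIV. \<Sum>k\<in>UNIV. \<Sum>l\<in>UNIV.
    curv_comp G (x v) i j k l * e a v $ i * e b v $ j * e c v $ k * e d v $ l)"

lemma ambient_curv_D:
  assumes v: "v \<in> W"
  shows "ambient_curv v a b c d = gm v (D c (D d (e b)) v - D d (D c (e b)) v) (e a v)"
proof -
  let ?R = "\<lambda>f j k l. curvature G (coord_field k) (coord_field l) (coord_field j) (x v) $ f"
  have "ambient_curv v a b c d = (\<Sum>i\<in>UNIV. \<Sum>j\<in>UNIV. \<Sum>k\<in>UNIV. \<Sum>l\<in>UNIV. \<Sum>f\<in>UNIV.
    G (x v) $ f $ i * ?R f j k l * e a v $ i * e b v $ j * e c v $ k * e d v $ l)"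
    by (simp add: ambient_curv_def curv_comp_sum sum_distrib_right)
  also have "\<dots> = (\<Sum>i\<in>UNIV. \<Sum>j\<in>UNIV. \<Sum>k\<in>UNIV. \<Sum>f\<in>UNIV. \<Sum>l\<in>UNIV.
    G (x v) $ f $ i * ?R f j k l * e a v $ i * e b v $ j * e c v $ k * e d v $ l)"
    by (rule sum.cong[OF refl], rule sum.cong[OF refl], rule sum.cong[OF refl], rule sum.swap)
  also have "\<dots> = (\<Sum>i\<in>UNIV. \<Sum>j\<in>UNIV. \<Sum>f\<in>UNIV. \<Sum>k\<in>UNIV. \<Sum>l\<in>UNIV.
    G (x v) $ f $ i * ?R f j k l * e a v $ i * e b v $ j * e c v $ k * e d v $ l)"
    by (rule sum.cong[OF refl], rule sum.cong[OF refl], rule sum.swap)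
  also have "\<dots> = (\<Sum>i\<in>UNIV. \<Sum>f\<in>UNIV. \<Sum>j\<in>UNIV. \<Sum>k\<in>UNIV. \<Sum>l\<in>UNIV.
    G (x v) $ f $ i * ?R f j k l * e a v $ i * e b v $ j * e c v $ k * e d v $ l)"
    by (rule sum.cong[OF refl], rule sum.swap)
  also have "\<dots> = (\<Sum>f\<in>UNIV. \<Sum>i\<in>UNIV. \<Sum>j\<in>UNIV. \<Sum>k\<in>UNIV. \<Sum>l\<in>UNIV.
    G (x v) $ f $ i * ?R f j k l * e a v $ i * e b v $ j * e c v $ k * e d v $ l)"
    by (rule sum.swap)
  also have "\<dots> = (\<Sum>f\<in>UNIV. \<Sum>i\<in>UNIV. G (x v) $ f $ i * (\<Sum>j\<in>UNIV. \<Sum>k\<in>UNIV. \<Sum>l\<in>UNIV.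
    ?R f j k l * e c v $ k * e d v $ l * e b v $ j) * e a v $ i)"
    by (simp add: sum_distrib_left sum_distrib_right mult_ac)
  also have "\<dots> = gm v (D c (D d (e b)) v - D d (D c (e b)) v) (e a v)"
    by (simp add: metric_def D_commutator[OF v, symmetric])
  finally show ?thesis .
qed

section \<open>Connection and curvature of the induced metric\<close>

abbreviation h :: "real^'n \<Rightarrow> real^'n^'n" where "h \<equiv> induced_metric G x"

text \<open>These turn out to be the Christoffel symbols of the induced metric with lowered upper
  index. Expressed through \<open>D\<close>, they are differentiated by
  \<open>partial_gm\<close>.\<close>

definition lowered :: "'n \<Rightarrow> 'n \<Rightarrow> 'n \<Rightarrow> real^'n \<Rightarrow> real" where
  "lowered m i j v = gm v (e m v) (D i (e j) v)"

lemma h_nth: "h v $ a $ b = gm v (e a v) (e b v)"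
  by (simp add: induced_metric_def)

lemma h_sym: "v \<in> W \<Longrightarrow> transpose (h v) = h v"
  by (simp add: vec_eq_iff transpose_def h_nth gm_commute)

lemma h_diff: "v \<in> W \<Longrightarrow> h differentiable at v"
  by (intro differentiable_vecI) (simp add: h_nth gm_diff e_diff)

lemma lowered_diff: "v \<in> W \<Longrightarrow> lowered m i j differentiable at v"
  unfolding lowered_def[abs_def] by (intro gm_diff e_diff D_e_diff)

text \<open>Raising the first index of \<open>lowered\<close> gives a candidate that is symmetric by
  \<open>D_e_commute\<close> and metric by \<open>partial_gm\<close>; uniqueness of the Levi-Civita
  connection identifies it.\<close>

lemma christoffel_h:
  assumes v: "v \<in> W"
  shows "christoffel h k i j v = (\<Sum>m\<in>UNIV. matrix_inv (h v) $ k $ m * lowered m i j v)"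
    and lowered_h: "lowered m i j v = (\<Sum>k\<in>UNIV. h v $ m $ k * christoffel h k i j v)"
proof -
  define \<Gamma> where "\<Gamma> k i j = (matrix_inv (h v) *v (\<chi> m. lowered m i j v)) $ k" for k i j
  have "h v *v (\<chi> k. \<Gamma> k i j) = (\<chi> m. lowered m i j v)" for i j
    using matrix_inv_right[OF h_inv[OF v]] by (simp add: \<Gamma>_def vec_lambda_eta matrix_vector_mul_assoc)
  then have L: "lowered m i j v = (\<Sum>k\<in>UNIV. h v $ m $ k * \<Gamma> k i j)" for m i j
    by (simp add: matrix_vector_mult_def vec_eq_iff)
  have hs: "h v $ i $ j = h v $ j $ i" for i j
    by (simp add: h_nth gm_commute[OF v])
  have 1: "\<Gamma> k i j = \<Gamma> k j i" for k i j
    by (simp add: \<Gamma>_def lowered_def D_e_commute[OF v, of i j])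
  have 2: "partial k (\<lambda>y. h y $ i $ j) v = (\<Sum>l\<in>UNIV. \<Gamma> l k i * h v $ l $ j + \<Gamma> l k j * h v $ i $ l)" for k i j
  proof -
    have "partial k (\<lambda>y. h y $ i $ j) v = lowered j k i v + lowered i k j v"
      by (simp add: h_nth partial_gm[OF v e_diff[OF v] e_diff[OF v]] lowered_def gm_commute[OF v, of _ "e j v"])
    then show ?thesis by (simp add: L sum.distrib hs[of j] mult.commute)
  qed
  have 3: "\<forall>k i j. \<Gamma> k i j = christoffel h k i j v"
    by (rule iffD2[OF christoffel_unique[OF open_W v h_sym h_diff[OF v] h_inv[OF v]]])
      (use 1 2 in simp_all)
  have "\<Gamma> k i j = (\<Sum>m\<in>UNIV. matrix_inv (h v) $ k $ m * lowered m i j v)"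
    by (simp add: \<Gamma>_def matrix_vector_mult_def)
  then show "christoffel h k i j v = (\<Sum>m\<in>UNIV. matrix_inv (h v) $ k $ m * lowered m i j v)"
    using 3 by simp
  show "lowered m i j v = (\<Sum>k\<in>UNIV. h v $ m $ k * christoffel h k i j v)"
    using 3 by (simp add: L)
qed

text \<open>The expression through \<open>lowered\<close> has differentiable factors; this avoids
  establishing smoothness of all orders for the induced metric.\<close>

lemma christoffel_h_diff: "v \<in> W \<Longrightarrow> christoffel h k i j differentiable at v"
proof -
  assume v: "v \<in> W"
  have "(\<lambda>v. \<Sum>m\<in>UNIV. matrix_inv (h v) $ k $ m * lowered m i j v) differentiable at v"
    by (intro differentiable_sum ballI differentiable_mult lowered_diff[OF v]
      differentiable_matrix_inv[OF open_W v h_inv h_diff[OF v]]) simp_all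
  then show ?thesis
    using differentiable_cong_open[OF open_W v, of "christoffel h k i j"
        "\<lambda>v. \<Sum>m\<in>UNIV. matrix_inv (h v) $ k $ m * lowered m i j v"] christoffel_h(1) by blast
qed

text \<open>In the derivative of \<open>lowered\<close>, the second covariant derivatives assemble
  into the ambient curvature and the product of first ones is split by the normal frame. Its
  tangential part cancels the quadratic terms of \<open>curv_comp_lowered\<close>, its normal part
  is the quadratic expression in \<open>S\<close>.\<close>

theorem gauss_equation:
  fixes N :: "'p::finite \<Rightarrow> real^'n \<Rightarrow> real^'m"
  assumes card: "CARD('m) = CARD('n) + CARD('p)" and N: "normal_frame G x N W" and v: "v \<in> W"
  defines "S \<equiv> \<lambda>A a b. gm v (D a (N A) v) (e b v)"
  shows "S A a b = S A b a"
    and "curv_comp h v a b c d = ambient_curv v a b c d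
      + (\<Sum>A\<in>UNIV. S A a c * S A b d - S A a d * S A b c)"
proof -
  have N_diff: "N A differentiable at v" for A
    using N v by (auto simp: normal_frame_def intro: smooth_on_differentiable)
  \<comment> \<open>Differentiating the relation of orthogonality between \<open>N A\<close> and
    \<open>e b\<close> moves the derivative from one factor to the other; \<open>S\<close> is thus
    minus the second fundamental form.\<close>
  have S: "gm v (N A v) (D a (e b) v) = - S A a b" for A a b
  proof -
    have "partial a (\<lambda>v. gm v (N A v) (e b v)) v = partial a (\<lambda>v. 0) v"
      using N by (intro partial_cong[OF open_W v]) (simp add: normal_frame_def)
    then show ?thesis
      using partial_gm[OF v N_diff e_diff[OF v], of a A b] by (simp add: S_def)
  qed
  show Ssym: "S A a b = S A b a" for A a b
    using S[of A a b] S[of A b a] D_e_commute[OF v, of a b] by simp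
  have split: "gm v V Z = (\<Sum>a\<in>UNIV. \<Sum>b\<in>UNIV. matrix_inv (h v) $ a $ b * gm v (e b v) V * gm v (e a v) Z)
     + (\<Sum>A\<in>UNIV. gm v (N A v) V * gm v (N A v) Z)" for V Z
  proof (rule normal_decomposition[where N = "\<lambda>A. N A v", OF card])
    show "metric G (x v) (N A v) (N B v) = (if A = B then 1 else 0)" "metric G (x v) (N A v) (e a v) = 0" for A B a
      using N v by (simp_all add: normal_frame_def)
  qed (use v in \<open>simp_all add: G_sym x_in h_inv h_nth\<close>)
  have decomp: "gm v (D d (e b) v) (D c (e a) v) =
      (\<Sum>f\<in>UNIV. lowered f c a v * christoffel h f d b v) + (\<Sum>A\<in>UNIV. S A b d * S A a c)" for a b c d
  proof -
    have "gm v (D d (e b) v) (D c (e a) v) =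
      (\<Sum>f\<in>UNIV. \<Sum>m\<in>UNIV. matrix_inv (h v) $ f $ m * lowered m d b v * lowered f c a v) + (\<Sum>A\<in>UNIV. S A d b * S A c a)"
      by (subst split) (simp add: S lowered_def)
    then show ?thesis
      by (simp add: christoffel_h(1)[OF v] sum_distrib_left mult_ac Ssym)
  qed
  have half: "partial c (lowered a d b) v = gm v (D c (D d (e b)) v) (e a v) + gm v (D d (e b) v) (D c (e a) v)" for a b c d
    unfolding lowered_def[abs_def] partial_gm[OF v e_diff[OF v] D_e_diff[OF v]]
    by (simp add: gm_commute[OF v])
  show "curv_comp h v a b c d = ambient_curv v a b c d
      + (\<Sum>A\<in>UNIV. S A a c * S A b d - S A a d * S A b c)"
    using curv_comp_lowered[OF open_W h_sym h_inv h_diff v lowered_h christoffel_h_diff[OF v], of a b c d]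
    by (simp add: half decomp ambient_curv_D[OF v] metric_linear sum_subtractf mult.commute)
qed

end

section \<open>Curvature in terms of Nambu brackets\<close>

text \<open>The first slot of the bracket is split off into the coefficient, which leaves a sum over
  lists of the shape handled by \<open>multi_metric_contraction\<close>.\<close>

lemma P_tensor_expand:
  fixes x :: "real^'n::finite \<Rightarrow> real^'m::finite"
  assumes x: "x differentiable at u" and J: "J \<in> multi_indices (CARD('n) - 1)"
  shows "P_tensor ord \<rho> x u i J = (1 / sqrt (fact (CARD('n) - 1)) / \<rho> u) *
    (\<Sum>as\<in>multi_indices (CARD('n) - 1). (\<Sum>a\<in>UNIV. eps ord (a # as) * partial a x u $ i) *
      (\<Prod>s<CARD('n) - 1. partial (as ! s) x u $ (J ! s)))"
proof -
  obtain r where r: "CARD('n) = Suc r" by (metis card_eq_0_iff finite_UNIV UNIV_not_empty not0_implies_Suc finite)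
  have prod: "(\<Prod>s<Suc r. partial ((a # as) ! s) (map (\<lambda>j v. x v $ j) (i # J) ! s) u) =
      partial a x u $ i * (\<Prod>s<r. partial (as ! s) x u $ (J ! s))" for a as
    using J r by (simp add: prod.lessThan_Suc_shift partial_vec_nth[OF x] multi_indices_def del: prod.lessThan_Suc)
  have "(\<Sum>as\<in>multi_indices CARD('n). eps ord as * (\<Prod>s<CARD('n). partial (as ! s) (map (\<lambda>j v. x v $ j) (i # J) ! s) u))
     = (\<Sum>a\<in>UNIV. \<Sum>as\<in>multi_indices r. eps ord (a # as) * (partial a x u $ i * (\<Prod>s<r. partial (as ! s) x u $ (J ! s))))"
    unfolding r sum_multi_indices_Suc prod ..
  also have "\<dots> = (\<Sum>as\<in>multi_indices r. (\<Sum>a\<in>UNIV. eps ord (a # as) * partial a x u $ i) * (\<Prod>s<r. partial (as ! s) x u $ (J ! s)))"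
    by (subst sum.swap) (simp add: sum_distrib_right mult.assoc)
  finally show ?thesis by (simp add: P_tensor_def nambu_def r)
qed

lemma T_tensor_expand:
  fixes x :: "real^'n::finite \<Rightarrow> real^'m::finite"
  assumes ord: "bij_betw ord {..<CARD('n)} UNIV" and x: "x differentiable at u"
  shows "T_tensor ord \<rho> G x N u I j = (- 1 / sqrt (fact (CARD('n) - 1)) / \<rho> u) *
    (\<Sum>as\<in>multi_indices (CARD('n) - 1). (\<Sum>a\<in>UNIV. eps ord (a # as) * nabla_along G x a N u $ j) *
      (\<Prod>s<CARD('n) - 1. partial (as ! s) x u $ (I ! s)))"
proof -
  have r: "CARD('n) = Suc (CARD('n) - 1)" by simp
  have "(-1) ^ CARD('n) * eps ord (as @ [a]) = - eps ord (a # as)"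
    if "as \<in> multi_indices (CARD('n) - 1)" for a and as :: "'n list"
  proof -
    \<comment> \<open>The definition contributes \<open>CARD('n)\<close> signs and the rotation of
      the last index one fewer, so a single minus remains for every dimension.\<close>
    have "(-1) ^ Suc k * (-1) ^ k = (-1 :: real)" for k
      by (induction k) simp_all
    then have "(-1) ^ CARD('n) * (-1) ^ (CARD('n) - 1) = (-1 :: real)"
      using r by metis
    then show ?thesis
      using eps_rotate[OF ord, of "[]" as a] that by (simp add: multi_indices_def mult.assoc[symmetric])
  qed
  then have "((-1) ^ CARD('n)) * (\<Sum>as\<in>multi_indices (CARD('n) - 1). \<Sum>a\<in>UNIV. eps ord (as @ [a]) *
      ((\<Prod>r<CARD('n) - 1. partial (as ! r) x u $ (I ! r)) * nabla_along G x a N u $ j)) =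
     - (\<Sum>as\<in>multi_indices (CARD('n) - 1). (\<Sum>a\<in>UNIV. eps ord (a # as) * nabla_along G x a N u $ j) *
      (\<Prod>s<CARD('n) - 1. partial (as ! s) x u $ (I ! s)))"
    unfolding sum_distrib_left sum_negf[symmetric] sum_distrib_right mult.assoc[symmetric]
    by (intro sum.cong refl) (simp add: sum_distrib_left mult_ac)
  then show ?thesis
    by (simp add: T_tensor_def partial_vec_nth[OF x] sum_divide_distrib[symmetric] mult.assoc)
qed

text \<open>Contracting the tangent factors turns the ambient metric into \<open>h\<close>, after
  which \<open>sum_eps_cofactor\<close> evaluates the symbols. The free slots \<open>P\<close> and
  \<open>Q\<close> are left open: \<open>P_sq\<close> has tangent vectors in both, while
  \<open>B_tensor\<close> has a derivative of the normal field in the second.\<close>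

lemma sum_eps_multi_metric:
  fixes p :: "'n::finite \<Rightarrow> 'm::finite \<Rightarrow> real" and B :: "real^'m^'m" and h :: "real^'n^'n"
  assumes ord: "bij_betw ord {..<CARD('n)} UNIV" and h: "invertible h"
    "\<And>a b. h $ a $ b = (\<Sum>k\<in>UNIV. \<Sum>l\<in>UNIV. p a k * p b l * B $ k $ l)"
  shows "(\<Sum>I\<in>multi_indices (CARD('n) - 1). \<Sum>J\<in>multi_indices (CARD('n) - 1).
      (\<Sum>as\<in>multi_indices (CARD('n) - 1). (\<Sum>a\<in>UNIV. eps ord (a # as) * P a) * (\<Prod>s<CARD('n) - 1. p (as ! s) (I ! s))) *
      (\<Sum>bs\<in>multi_indices (CARD('n) - 1). (\<Sum>b\<in>UNIV. eps ord (b # bs) * Q b) * (\<Prod>s<CARD('n) - 1. p (bs ! s) (J ! s))) *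
      multi_metric B I J) =
    fact (CARD('n) - 1) * det h * (\<Sum>a\<in>UNIV. \<Sum>b\<in>UNIV. matrix_inv h $ b $ a * P a * Q b)"
proof -
  let ?N = "multi_indices (CARD('n) - 1) :: 'n list set"
  let ?h = "\<lambda>as bs. \<Prod>s<CARD('n) - 1. h $ (as ! s) $ (bs ! s)"
  have "(\<Sum>as\<in>?N. \<Sum>bs\<in>?N. (\<Sum>a\<in>UNIV. eps ord (a # as) * P a) * (\<Sum>b\<in>UNIV. eps ord (b # bs) * Q b) * ?h as bs)
    = (\<Sum>as\<in>?N. \<Sum>bs\<in>?N. \<Sum>a\<in>UNIV. \<Sum>b\<in>UNIV. P a * Q b * (eps ord (a # as) * eps ord (b # bs) * ?h as bs))"
    by (simp add: sum_product) (simp add: sum_distrib_left mult_ac)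
  also have "\<dots> = (\<Sum>as\<in>?N. \<Sum>a\<in>UNIV. \<Sum>b\<in>UNIV. \<Sum>bs\<in>?N. P a * Q b * (eps ord (a # as) * eps ord (b # bs) * ?h as bs))"
    by (rule sum.cong[OF refl], subst sum.swap, rule sum.cong[OF refl], rule sum.swap)
  also have "\<dots> = (\<Sum>a\<in>UNIV. \<Sum>b\<in>UNIV. \<Sum>as\<in>?N. \<Sum>bs\<in>?N. P a * Q b * (eps ord (a # as) * eps ord (b # bs) * ?h as bs))"
    by (subst sum.swap, rule sum.cong[OF refl], rule sum.swap)
  also have "\<dots> = (\<Sum>a\<in>UNIV. \<Sum>b\<in>UNIV. P a * Q b * (fact (CARD('n) - 1) * det h * matrix_inv h $ b $ a))"
    by (simp only: sum_eps_cofactor[OF ord h(1)] sum_distrib_left[symmetric])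
  also have "\<dots> = fact (CARD('n) - 1) * det h * (\<Sum>a\<in>UNIV. \<Sum>b\<in>UNIV. matrix_inv h $ b $ a * P a * Q b)"
    by (simp add: sum_distrib_left mult_ac)
  finally show ?thesis
    unfolding multi_metric_contraction[where p = p and q = p
        and \<alpha> = "\<lambda>as. \<Sum>a\<in>UNIV. eps ord (a # as) * P a" and \<beta> = "\<lambda>bs. \<Sum>b\<in>UNIV. eps ord (b # bs) * Q b"]
    by (simp only: h(2))
qed

lemma matrix_inv_symmetric:
  fixes H :: "real^'n^'n::finite"
  assumes "invertible H" "transpose H = H"
  shows "transpose (matrix_inv H) = matrix_inv H"
proof -
  have "transpose (matrix_inv H) = transpose (matrix_inv H) ** (transpose H ** matrix_inv H)"
    using matrix_inv_right[OF assms(1)] by (simp add: assms(2))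
  also have "\<dots> = transpose (H ** matrix_inv H) ** matrix_inv H"
    by (simp add: matrix_mul_assoc matrix_transpose_mul)
  finally show ?thesis using matrix_inv_right[OF assms(1)] by simp
qed

lemma trace_scaleR: "trace (r *\<^sub>R A) = r * trace A"
  for A :: "real^'n^'n::finite"
  by (simp add: trace_def sum_distrib_left)

lemma trace_sum: "trace (\<Sum>i\<in>I. A i) = (\<Sum>i\<in>I. trace (A i))"
  for A :: "'i \<Rightarrow> real^'n^'n::finite"
  by (simp add: trace_def) (rule sum.swap)

lemma scaled_product: "(c * X) * (d * nabla_sharp) * m = (c * d) * (X * nabla_sharp * m)"
  for c d X nabla_sharp m :: real
  by simp

context submanifold_patch
begin

context
  fixes ord :: "nat \<Rightarrow> 'n" and \<rho> :: "real^'n \<Rightarrow> real" and u :: "real^'n"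
  assumes ord: "bij_betw ord {..<CARD('n)} UNIV" and u: "u \<in> W" and \<rho>: "\<rho> u \<noteq> 0"
begin

text \<open>For a positive determinant this is the square of \<open>gamma\<close>, written without
  the root.\<close>

definition \<kappa> :: real where "\<kappa> = det (h u) / (\<rho> u)\<^sup>2"

definition E :: "real^'n^'m" where "E = (\<chi> i a. e a u $ i)"

abbreviation H' :: "real^'n^'n" where "H' \<equiv> matrix_inv (h u)"

lemma H'_sym: "H' $ a $ b = H' $ b $ a"
proof -
  have "transpose H' $ b $ a = H' $ b $ a"
    by (simp only: matrix_inv_symmetric[OF h_inv[OF u] h_sym[OF u]])
  then show ?thesis by (simp add: transpose_def)
qed

lemma h_sum: "h u $ a $ b = (\<Sum>k\<in>UNIV. \<Sum>l\<in>UNIV. e a u $ k * e b u $ l * G (x u) $ k $ l)"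
  by (simp add: h_nth metric_def mult_ac)

text \<open>Squaring \<open>sqrt\<close> gives the absolute value of the determinant, and the next
  square removes the absolute value; the identity therefore holds for either sign of the
  determinant.\<close>

lemma gamma_power4: "gamma \<rho> G x u ^ 4 = \<kappa>\<^sup>2"
proof -
  have "sqrt (det (h u)) ^ 4 = (sqrt (det (h u)) * sqrt (det (h u)))\<^sup>2"
    by (simp only: power_mult[symmetric] power2_eq_square[symmetric]) simp
  also have "\<dots> = (det (h u))\<^sup>2" by (simp add: real_sqrt_mult_self)
  finally show ?thesis by (simp add: gamma_def \<kappa>_def power_divide)
qed

lemma \<kappa>_nonzero: "\<kappa> \<noteq> 0"
  using h_inv[OF u] \<rho> by (simp add: \<kappa>_def invertible_det_nz)

lemma normalisation: "(1 / sqrt (fact r) / \<rho> u)\<^sup>2 * fact r * det (h u) = \<kappa>"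
  by (simp add: \<kappa>_def power_divide power_mult_distrib)

lemma P_sq_nth: "P_sq ord \<rho> G x u $ i $ k = \<kappa> * (\<Sum>a\<in>UNIV. \<Sum>b\<in>UNIV. H' $ a $ b * e a u $ i * e b u $ k)"
proof -
  let ?M = "multi_indices (CARD('n) - 1) :: 'm list set"
  let ?c = "1 / sqrt (fact (CARD('n) - 1)) / \<rho> u"
  let ?X = "\<lambda>i I. (\<Sum>as\<in>multi_indices (CARD('n) - 1). (\<Sum>a\<in>UNIV. eps ord (a # as) * e a u $ i) *
      (\<Prod>s<CARD('n) - 1. e (as ! s) u $ (I ! s)))"
  have "P_sq ord \<rho> G x u $ i $ k = (\<Sum>I\<in>?M. \<Sum>J\<in>?M. (?c * ?X i I) * (?c * ?X k J) * multi_metric (G (x u)) I J)"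
    unfolding P_sq_def by (simp add: P_tensor_expand[OF x_diff[OF u]] cong: sum.cong)
  also have "\<dots> = ?c\<^sup>2 * (\<Sum>I\<in>?M. \<Sum>J\<in>?M. ?X i I * ?X k J * multi_metric (G (x u)) I J)"
    by (simp only: scaled_product[of ?c _ ?c] sum_distrib_left[symmetric] power2_eq_square)
  also have "\<dots> = ?c\<^sup>2 * (fact (CARD('n) - 1) * det (h u) * (\<Sum>a\<in>UNIV. \<Sum>b\<in>UNIV. H' $ b $ a * e a u $ i * e b u $ k))"
    by (subst sum_eps_multi_metric[OF ord h_inv[OF u] h_sum]) (rule refl)
  also have "\<dots> = (?c\<^sup>2 * fact (CARD('n) - 1) * det (h u)) * (\<Sum>a\<in>UNIV. \<Sum>b\<in>UNIV. H' $ a $ b * e a u $ i * e b u $ k)"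
    by (simp only: H'_sym mult.assoc)
  also have "?c\<^sup>2 * fact (CARD('n) - 1) * det (h u) = \<kappa>"
    by (rule normalisation)
  finally show ?thesis .
qed

text \<open>Same contraction as for \<open>P_sq\<close>, with the second free slot taken by the
  derivative of the normal field; the minus is the one left over in
  \<open>T_tensor_expand\<close>.\<close>

lemma B_tensor_nth: "B_tensor ord \<rho> G x N u $ i $ k = - \<kappa> * (\<Sum>a\<in>UNIV. \<Sum>b\<in>UNIV. H' $ a $ b * e a u $ i * D b N u $ k)"
proof -
  let ?M = "multi_indices (CARD('n) - 1) :: 'm list set"
  let ?c = "1 / sqrt (fact (CARD('n) - 1)) / \<rho> u" and ?d = "- 1 / sqrt (fact (CARD('n) - 1)) / \<rho> u"
  let ?X = "\<lambda>P I. (\<Sum>as\<in>multi_indices (CARD('n) - 1). (\<Sum>a\<in>UNIV. eps ord (a # as) * P a) *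
      (\<Prod>s<CARD('n) - 1. e (as ! s) u $ (I ! s)))"
  let ?P = "\<lambda>a. e a u $ i" and ?Q = "\<lambda>b. D b N u $ k"
  have "B_tensor ord \<rho> G x N u $ i $ k = (\<Sum>I\<in>?M. \<Sum>J\<in>?M. (?c * ?X ?P I) * (?d * ?X ?Q J) * multi_metric (G (x u)) I J)"
    unfolding B_tensor_def by (simp add: P_tensor_expand[OF x_diff[OF u]] T_tensor_expand[OF ord x_diff[OF u]] cong: sum.cong)
  also have "\<dots> = (?c * ?d) * (\<Sum>I\<in>?M. \<Sum>J\<in>?M. ?X ?P I * ?X ?Q J * multi_metric (G (x u)) I J)"
    by (simp only: scaled_product[of ?c _ ?d] sum_distrib_left[symmetric])
  also have "\<dots> = (?c * ?d) * (fact (CARD('n) - 1) * det (h u) * (\<Sum>a\<in>UNIV. \<Sum>b\<in>UNIV. H' $ b $ a * e a u $ i * D b N u $ k))"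
    by (subst sum_eps_multi_metric[OF ord h_inv[OF u] h_sum]) (rule refl)
  also have "\<dots> = (?c * ?d * fact (CARD('n) - 1) * det (h u)) * (\<Sum>a\<in>UNIV. \<Sum>b\<in>UNIV. H' $ a $ b * e a u $ i * D b N u $ k)"
    by (simp only: H'_sym mult.assoc)
  also have "?c * ?d * fact (CARD('n) - 1) * det (h u) = - \<kappa>"
  proof -
    have "?c * ?d = - (?c\<^sup>2)" by (simp add: power2_eq_square)
    then show ?thesis using normalisation by simp
  qed
  finally show ?thesis .
qed

lemma tangent_vec_E: "tangent_vec x u \<xi> = E *v \<xi>"
  by (simp add: vec_eq_iff tangent_vec_def E_def matrix_vector_mult_def mult.commute)

text \<open>Pairs an ambient vector with the derivatives \<open>D b N\<close> and raises the index
  by the inverse induced metric. It is the factor of \<open>B_map\<close> that leads from the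
  ambient tangent space to tangent coefficients, while \<open>E\<close> leads back.\<close>

definition nabla_sharp :: "(real^'n \<Rightarrow> real^'m) \<Rightarrow> real^'m^'n" where
  "nabla_sharp N = H' ** (\<chi> b k. D b N u $ k) ** G (x u)"

text \<open>This is minus the usual Weingarten map, and \<open>B_map\<close> acts on tangent vectors as \<open>- \<kappa>\<close> times it;
  the signs cancel because both enter the curvature only quadratically.\<close>

definition weingarten :: "(real^'n \<Rightarrow> real^'m) \<Rightarrow> real^'n^'n" where
  "weingarten N = H' ** (\<chi> a b. gm u (D a N u) (e b u))"

lemma nabla_sharp_basis: "nabla_sharp N ** E = weingarten N"
proof -
  have "(\<chi> b k. D b N u $ k) ** G (x u) ** E = (\<chi> a b. gm u (D a N u) (e b u))"
    by (simp add: vec_eq_iff matrix_matrix_mult_def E_def metric_def sum_distrib_right)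
      (subst sum.swap, simp add: mult_ac)
  then show ?thesis by (simp add: nabla_sharp_def weingarten_def matrix_mul_assoc[symmetric])
qed

lemma B_map_eq: "B_map ord \<rho> G x N u = (- \<kappa>) *\<^sub>R (E ** nabla_sharp N)"
proof -
  have "B_tensor ord \<rho> G x N u = (- \<kappa>) *\<^sub>R (E ** (H' ** (\<chi> b k. D b N u $ k)))"
    by (simp add: vec_eq_iff B_tensor_nth matrix_matrix_mult_def E_def sum_distrib_left sum_negf mult_ac)
  then show ?thesis
    by (simp add: B_map_def nabla_sharp_def matrix_mul_assoc scalar_matrix_assoc)
qed

text \<open>Cyclicity moves \<open>E\<close> to the other side of \<open>nabla_sharp\<close>, where
  the product collapses to \<open>weingarten\<close>. The trace of the square is reduced in the same
  way.\<close>

lemma trace_B_map: "trace (B_map ord \<rho> G x N u) = - \<kappa> * trace (weingarten N)"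
  unfolding B_map_eq trace_scaleR by (subst trace_mul_sym) (simp add: nabla_sharp_basis)

lemma trace_B_map_sq: "trace (B_map ord \<rho> G x N u ** B_map ord \<rho> G x N u) = \<kappa>\<^sup>2 * trace (weingarten N ** weingarten N)"
proof -
  have "(r *\<^sub>R (E ** nabla_sharp N)) ** (r *\<^sub>R (E ** nabla_sharp N)) = (r * r) *\<^sub>R (E ** (weingarten N ** nabla_sharp N))" for r
    unfolding nabla_sharp_basis[symmetric] by (simp add: scalar_matrix_assoc[symmetric] matrix_scalar_ac matrix_mul_assoc)
  from this[of "- \<kappa>"]
  have "B_map ord \<rho> G x N u ** B_map ord \<rho> G x N u = \<kappa>\<^sup>2 *\<^sub>R (E ** (weingarten N ** nabla_sharp N))"
    unfolding B_map_eq by (simp add: power2_eq_square)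
  then have "trace (B_map ord \<rho> G x N u ** B_map ord \<rho> G x N u) = \<kappa>\<^sup>2 * trace (E ** (weingarten N ** nabla_sharp N))"
    by (simp add: trace_scaleR)
  also have "trace (E ** (weingarten N ** nabla_sharp N)) = trace (weingarten N ** (nabla_sharp N ** E))"
    by (subst trace_mul_sym) (simp add: matrix_mul_assoc)
  finally show ?thesis by (simp add: nabla_sharp_basis)
qed

lemma B_map_E: "B_map ord \<rho> G x N u *v (E *v \<xi>) = (- \<kappa>) *\<^sub>R (E *v (weingarten N *v \<xi>))"
proof -
  have "(r *\<^sub>R (E ** nabla_sharp N)) *v (E *v \<xi>) = r *\<^sub>R (E *v (weingarten N *v \<xi>))" for r
    unfolding nabla_sharp_basis[symmetric]
    by (simp add: matrix_vector_mul_assoc matrix_mul_assoc scaleR_matrix_vector_assoc[symmetric] scalar_matrix_assoc[symmetric])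
  then show ?thesis unfolding B_map_eq .
qed

text \<open>Only tangent directions are contracted, so this is in general not the Ricci curvature of
  the ambient manifold.\<close>

definition ambient_ricci :: "real^'n^'n" where
  "ambient_ricci = (\<chi> q b. \<Sum>a\<in>UNIV. \<Sum>c\<in>UNIV. \<Sum>d\<in>UNIV. H' $ a $ c * H' $ q $ d * ambient_curv u a b c d)"

lemma ricci_eq:
  fixes N :: "'p::finite \<Rightarrow> real^'n \<Rightarrow> real^'m"
  assumes card: "CARD('m) = CARD('n) + CARD('p)" and N: "normal_frame G x N W"
  shows "ricci_map h u = ambient_ricci + (\<Sum>A\<in>UNIV. trace (weingarten (N A)) *\<^sub>R weingarten (N A) - weingarten (N A) ** weingarten (N A))"
proof -
  define S where "S A a b = gm u (D a (N A) u) (e b u)" for A a b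
  have Ssym: "S A a b = S A b a" for A a b
    unfolding S_def by (rule gauss_equation(1)[OF card N u])
  have gauss: "curv_comp h u a b c d = ambient_curv u a b c d + (\<Sum>A\<in>UNIV. S A a c * S A b d - S A a d * S A b c)" for a b c d
    unfolding S_def by (rule gauss_equation(2)[OF card N u])
  have Wnth: "weingarten (N A) $ q $ b = (\<Sum>d\<in>UNIV. H' $ q $ d * S A d b)" for A q b
    by (simp add: weingarten_def matrix_matrix_mult_def S_def)
  \<comment> \<open>In the first product \<open>a\<close> and \<open>c\<close> close up to a trace
    and \<open>d\<close> forms one Weingarten matrix; in the second the indices \<open>d\<close>,
    \<open>a\<close>, \<open>c\<close> form a chain, which by symmetry of \<open>S\<close> is the
    matrix square.\<close>
  have quad: "(\<Sum>a\<in>UNIV. \<Sum>c\<in>UNIV. \<Sum>d\<in>UNIV. H' $ a $ c * H' $ q $ d * (S A a c * S A b d - S A a d * S A b c))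
     = trace (weingarten (N A)) * weingarten (N A) $ q $ b - (weingarten (N A) ** weingarten (N A)) $ q $ b" for A q b
  proof -
    have 1: "(\<Sum>a\<in>UNIV. \<Sum>c\<in>UNIV. \<Sum>d\<in>UNIV. H' $ a $ c * H' $ q $ d * (S A a c * S A b d))
      = trace (weingarten (N A)) * weingarten (N A) $ q $ b"
    proof -
      have "trace (weingarten (N A)) * weingarten (N A) $ q $ b = (\<Sum>a\<in>UNIV. \<Sum>c\<in>UNIV. H' $ a $ c * S A a c) * (\<Sum>d\<in>UNIV. H' $ q $ d * S A b d)"
        by (simp add: trace_def Wnth Ssym)
      also have "\<dots> = (\<Sum>a\<in>UNIV. \<Sum>c\<in>UNIV. (H' $ a $ c * S A a c) * (\<Sum>d\<in>UNIV. H' $ q $ d * S A b d))"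
        by (simp only: sum_distrib_right)
      finally show ?thesis by (simp add: sum_distrib_left mult_ac)
    qed
    have 2: "(\<Sum>a\<in>UNIV. \<Sum>c\<in>UNIV. \<Sum>d\<in>UNIV. H' $ a $ c * H' $ q $ d * (S A a d * S A b c))
      = (weingarten (N A) ** weingarten (N A)) $ q $ b"
    proof -
      have "(weingarten (N A) ** weingarten (N A)) $ q $ b = (\<Sum>a\<in>UNIV. (\<Sum>d\<in>UNIV. H' $ q $ d * S A a d) * (\<Sum>c\<in>UNIV. H' $ a $ c * S A b c))"
        by (simp add: matrix_matrix_mult_def[of "weingarten _" "weingarten _"] Wnth Ssym)
      also have "\<dots> = (\<Sum>a\<in>UNIV. \<Sum>c\<in>UNIV. \<Sum>d\<in>UNIV. H' $ a $ c * H' $ q $ d * (S A a d * S A b c))"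
        by (subst sum_product, rule sum.cong[OF refl], subst sum.swap) (simp add: mult_ac)
      finally show ?thesis ..
    qed
    show ?thesis by (simp only: right_diff_distrib sum_subtractf 1 2)
  qed
  have "ricci_map h u $ q $ b = ambient_ricci $ q $ b + (\<Sum>A\<in>UNIV. trace (weingarten (N A)) * weingarten (N A) $ q $ b - (weingarten (N A) ** weingarten (N A)) $ q $ b)" for q b
  proof -
    have "ricci_map h u $ q $ b = ambient_ricci $ q $ b + (\<Sum>a\<in>UNIV. \<Sum>c\<in>UNIV. \<Sum>d\<in>UNIV. \<Sum>A\<in>UNIV.
       H' $ a $ c * H' $ q $ d * (S A a c * S A b d - S A a d * S A b c))"
      by (simp add: ricci_map_def ambient_ricci_def gauss distrib_left sum.distrib sum_distrib_left)
    also have "(\<Sum>a\<in>UNIV. \<Sum>c\<in>UNIV. \<Sum>d\<in>UNIV. \<Sum>A\<in>UNIV.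
       H' $ a $ c * H' $ q $ d * (S A a c * S A b d - S A a d * S A b c))
     = (\<Sum>A\<in>UNIV. \<Sum>a\<in>UNIV. \<Sum>c\<in>UNIV. \<Sum>d\<in>UNIV.
       H' $ a $ c * H' $ q $ d * (S A a c * S A b d - S A a d * S A b c))"
    proof -
      have swap: "(\<Sum>a\<in>UNIV. \<Sum>c\<in>UNIV. \<Sum>d\<in>UNIV. \<Sum>A\<in>UNIV. f a c d A) = (\<Sum>A\<in>UNIV. \<Sum>a\<in>UNIV. \<Sum>c\<in>UNIV. \<Sum>d\<in>UNIV. f a c d A)"
        for f :: "'n \<Rightarrow> 'n \<Rightarrow> 'n \<Rightarrow> 'p \<Rightarrow> real"
        by (simp only: sum.swap[of _ _ "UNIV :: 'p set"])
      show ?thesis by (rule swap)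
    qed
    finally show ?thesis by (simp only: quad)
  qed
  then show ?thesis by (simp add: vec_eq_iff)
qed

lemma P_sq_curv:
  shows "(\<Sum>i\<in>UNIV. \<Sum>j\<in>UNIV. \<Sum>k\<in>UNIV. \<Sum>l\<in>UNIV.
      P_sq ord \<rho> G x u $ i $ k * P_sq ord \<rho> G x u $ l $ m * curv_comp G (x u) i j k l * (E *v \<xi>) $ j)
      = \<kappa>\<^sup>2 * (E *v (ambient_ricci *v \<xi>)) $ m"
    and "(\<Sum>i\<in>UNIV. \<Sum>j\<in>UNIV. \<Sum>k\<in>UNIV. \<Sum>l\<in>UNIV.
      P_sq ord \<rho> G x u $ i $ k * P_sq ord \<rho> G x u $ j $ l * curv_comp G (x u) i j k l)
      = \<kappa>\<^sup>2 * trace ambient_ricci"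
proof -
  \<comment> \<open>Contraction with the ambient curvature as a linear functional of a four-index
    array. Both arrays built from \<open>P_sq\<close> are combinations of products of tangent
    vectors, on which \<open>Q\<close> is \<open>ambient_curv\<close>.\<close>
  define Q where "Q f = (\<Sum>i\<in>UNIV. \<Sum>j\<in>UNIV. \<Sum>k\<in>UNIV. \<Sum>l\<in>UNIV. curv_comp G (x u) i j k l * f i j k l)" for f
  have Qsum: "Q (\<lambda>i j k l. \<Sum>a\<in>UNIV. f a i j k l) = (\<Sum>a\<in>UNIV. Q (f a))" for f :: "'n \<Rightarrow> 'm \<Rightarrow> 'm \<Rightarrow> 'm \<Rightarrow> 'm \<Rightarrow> real"
  proof -
    have swap: "(\<Sum>i\<in>UNIV. \<Sum>j\<in>UNIV. \<Sum>k\<in>UNIV. \<Sum>l\<in>UNIV. \<Sum>a\<in>UNIV. g a i j k l) =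
       (\<Sum>a\<in>UNIV. \<Sum>i\<in>UNIV. \<Sum>j\<in>UNIV. \<Sum>k\<in>UNIV. \<Sum>l\<in>UNIV. g a i j k l)" for g :: "'n \<Rightarrow> 'm \<Rightarrow> 'm \<Rightarrow> 'm \<Rightarrow> 'm \<Rightarrow> real"
      by (simp only: sum.swap[of _ "UNIV :: 'n set" "UNIV :: 'm set"])
    show ?thesis unfolding Q_def sum_distrib_left by (rule swap)
  qed
  have Qmult: "Q (\<lambda>i j k l. r * f i j k l) = r * Q f" for r f
    by (simp add: Q_def sum_distrib_left mult_ac)
  have amb: "ambient_curv u a b c d = Q (\<lambda>i j k l. e a u $ i * e b u $ j * e c u $ k * e d u $ l)" for a b c d
    by (simp add: ambient_curv_def Q_def mult.assoc)
  have "(\<Sum>i\<in>UNIV. \<Sum>j\<in>UNIV. \<Sum>k\<in>UNIV. \<Sum>l\<in>UNIV.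
      P_sq ord \<rho> G x u $ i $ k * P_sq ord \<rho> G x u $ l $ m * curv_comp G (x u) i j k l * (E *v \<xi>) $ j)
    = Q (\<lambda>i j k l. P_sq ord \<rho> G x u $ i $ k * P_sq ord \<rho> G x u $ l $ m * (E *v \<xi>) $ j)"
    by (simp add: Q_def mult_ac)
  also have "\<dots> = Q (\<lambda>i j k l. \<Sum>q\<in>UNIV. \<Sum>b\<in>UNIV. \<Sum>a\<in>UNIV. \<Sum>c\<in>UNIV. \<Sum>d\<in>UNIV.
         (\<kappa>\<^sup>2 * H' $ a $ c * H' $ q $ d * e q u $ m * \<xi> $ b) * (e a u $ i * e b u $ j * e c u $ k * e d u $ l))"
  proof (rule arg_cong[where f = Q], intro ext)
    fix i j k l
    \<comment> \<open>Symmetry of \<open>H'\<close> lets the free index \<open>m\<close> be carried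
      by \<open>q\<close>, the row index of \<open>ambient_ricci\<close>, and the contracted index
      \<open>l\<close> by \<open>d\<close>.\<close>
    have P2: "P_sq ord \<rho> G x u $ l $ m = \<kappa> * (\<Sum>q\<in>UNIV. \<Sum>d\<in>UNIV. H' $ q $ d * e q u $ m * e d u $ l)"
      unfolding P_sq_nth by (subst sum.swap) (simp add: H'_sym mult_ac)
    define PA where "PA = (\<Sum>a\<in>UNIV. \<Sum>c\<in>UNIV. H' $ a $ c * e a u $ i * e c u $ k)"
    have factor: "(\<Sum>q\<in>UNIV. \<Sum>b\<in>UNIV. \<Sum>d\<in>UNIV. f q d * g b) = (\<Sum>q\<in>UNIV. \<Sum>d\<in>UNIV. f q d) * (\<Sum>b\<in>UNIV. g b)"
      for f :: "'n \<Rightarrow> 'n \<Rightarrow> real" and g :: "'n \<Rightarrow> real"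
      by (simp only: sum_distrib_right[symmetric] sum_distrib_left[symmetric])
    have "(\<Sum>q\<in>UNIV. \<Sum>b\<in>UNIV. \<Sum>a\<in>UNIV. \<Sum>c\<in>UNIV. \<Sum>d\<in>UNIV.
         (\<kappa>\<^sup>2 * H' $ a $ c * H' $ q $ d * e q u $ m * \<xi> $ b) * (e a u $ i * e b u $ j * e c u $ k * e d u $ l))
       = (\<Sum>q\<in>UNIV. \<Sum>b\<in>UNIV. \<Sum>a\<in>UNIV. \<Sum>c\<in>UNIV. (H' $ a $ c * e a u $ i * e c u $ k) *
           (\<Sum>d\<in>UNIV. \<kappa>\<^sup>2 * (H' $ q $ d * e q u $ m * e d u $ l) * (\<xi> $ b * e b u $ j)))"
      by (simp add: sum_distrib_left mult_ac)
    also have "\<dots> = (\<Sum>q\<in>UNIV. \<Sum>b\<in>UNIV. (\<Sum>a\<in>UNIV. \<Sum>c\<in>UNIV. H' $ a $ c * e a u $ i * e c u $ k) *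
           (\<Sum>d\<in>UNIV. \<kappa>\<^sup>2 * (H' $ q $ d * e q u $ m * e d u $ l) * (\<xi> $ b * e b u $ j)))"
      by (simp only: sum_distrib_right)
    also have "\<dots> = PA * \<kappa>\<^sup>2 * ((\<Sum>q\<in>UNIV. \<Sum>d\<in>UNIV. H' $ q $ d * e q u $ m * e d u $ l) * (\<Sum>b\<in>UNIV. \<xi> $ b * e b u $ j))"
      unfolding PA_def[symmetric] factor[symmetric] by (simp add: sum_distrib_left mult_ac)
    also have "\<dots> = P_sq ord \<rho> G x u $ i $ k * P_sq ord \<rho> G x u $ l $ m * (E *v \<xi>) $ j"
      unfolding P2 unfolding P_sq_nth PA_def[symmetric]
      by (simp add: matrix_vector_mult_def E_def power2_eq_square mult_ac)
    finally show "P_sq ord \<rho> G x u $ i $ k * P_sq ord \<rho> G x u $ l $ m * (E *v \<xi>) $ j =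
      (\<Sum>q\<in>UNIV. \<Sum>b\<in>UNIV. \<Sum>a\<in>UNIV. \<Sum>c\<in>UNIV. \<Sum>d\<in>UNIV.
         (\<kappa>\<^sup>2 * H' $ a $ c * H' $ q $ d * e q u $ m * \<xi> $ b) * (e a u $ i * e b u $ j * e c u $ k * e d u $ l))" ..
  qed
  also have "\<dots> = (\<Sum>q\<in>UNIV. \<Sum>b\<in>UNIV. \<Sum>a\<in>UNIV. \<Sum>c\<in>UNIV. \<Sum>d\<in>UNIV.
         (\<kappa>\<^sup>2 * H' $ a $ c * H' $ q $ d * e q u $ m * \<xi> $ b) * ambient_curv u a b c d)"
    by (simp only: Qsum Qmult amb)
  also have "\<dots> = \<kappa>\<^sup>2 * (E *v (ambient_ricci *v \<xi>)) $ m"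
    by (simp add: matrix_vector_mult_def E_def ambient_ricci_def sum_distrib_left sum_distrib_right mult_ac)
  finally show "(\<Sum>i\<in>UNIV. \<Sum>j\<in>UNIV. \<Sum>k\<in>UNIV. \<Sum>l\<in>UNIV.
      P_sq ord \<rho> G x u $ i $ k * P_sq ord \<rho> G x u $ l $ m * curv_comp G (x u) i j k l * (E *v \<xi>) $ j)
      = \<kappa>\<^sup>2 * (E *v (ambient_ricci *v \<xi>)) $ m" .
  have "(\<Sum>i\<in>UNIV. \<Sum>j\<in>UNIV. \<Sum>k\<in>UNIV. \<Sum>l\<in>UNIV.
      P_sq ord \<rho> G x u $ i $ k * P_sq ord \<rho> G x u $ j $ l * curv_comp G (x u) i j k l)
    = Q (\<lambda>i j k l. P_sq ord \<rho> G x u $ i $ k * P_sq ord \<rho> G x u $ j $ l)"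
    by (simp add: Q_def mult_ac)
  also have "\<dots> = Q (\<lambda>i j k l. \<Sum>q\<in>UNIV. \<Sum>a\<in>UNIV. \<Sum>c\<in>UNIV. \<Sum>d\<in>UNIV.
         (\<kappa>\<^sup>2 * H' $ a $ c * H' $ q $ d) * (e a u $ i * e q u $ j * e c u $ k * e d u $ l))"
  proof (rule arg_cong[where f = Q], intro ext)
    fix i j k l
    have "(\<Sum>q\<in>UNIV. \<Sum>a\<in>UNIV. \<Sum>c\<in>UNIV. \<Sum>d\<in>UNIV.
         (\<kappa>\<^sup>2 * H' $ a $ c * H' $ q $ d) * (e a u $ i * e q u $ j * e c u $ k * e d u $ l))
       = (\<Sum>q\<in>UNIV. \<Sum>a\<in>UNIV. \<Sum>c\<in>UNIV. (H' $ a $ c * e a u $ i * e c u $ k) *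
           (\<Sum>d\<in>UNIV. \<kappa>\<^sup>2 * (H' $ q $ d * e q u $ j * e d u $ l)))"
      by (simp add: sum_distrib_left mult_ac)
    also have "\<dots> = (\<Sum>q\<in>UNIV. (\<Sum>a\<in>UNIV. \<Sum>c\<in>UNIV. H' $ a $ c * e a u $ i * e c u $ k) *
           (\<Sum>d\<in>UNIV. \<kappa>\<^sup>2 * (H' $ q $ d * e q u $ j * e d u $ l)))"
      by (simp only: sum_distrib_right)
    also have "\<dots> = P_sq ord \<rho> G x u $ i $ k * P_sq ord \<rho> G x u $ j $ l"
      unfolding P_sq_nth
      by (simp only: sum_distrib_left[symmetric] sum_distrib_right[symmetric])
        (simp add: power2_eq_square mult_ac)
    finally show "P_sq ord \<rho> G x u $ i $ k * P_sq ord \<rho> G x u $ j $ l =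
      (\<Sum>q\<in>UNIV. \<Sum>a\<in>UNIV. \<Sum>c\<in>UNIV. \<Sum>d\<in>UNIV.
         (\<kappa>\<^sup>2 * H' $ a $ c * H' $ q $ d) * (e a u $ i * e q u $ j * e c u $ k * e d u $ l))" ..
  qed
  also have "\<dots> = (\<Sum>q\<in>UNIV. \<Sum>a\<in>UNIV. \<Sum>c\<in>UNIV. \<Sum>d\<in>UNIV.
         (\<kappa>\<^sup>2 * H' $ a $ c * H' $ q $ d) * ambient_curv u a q c d)"
    by (simp only: Qsum Qmult amb)
  also have "\<dots> = \<kappa>\<^sup>2 * trace ambient_ricci"
    by (simp add: trace_def ambient_ricci_def sum_distrib_left mult_ac)
  finally show "(\<Sum>i\<in>UNIV. \<Sum>j\<in>UNIV. \<Sum>k\<in>UNIV. \<Sum>l\<in>UNIV.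
      P_sq ord \<rho> G x u $ i $ k * P_sq ord \<rho> G x u $ j $ l * curv_comp G (x u) i j k l)
      = \<kappa>\<^sup>2 * trace ambient_ricci" .
qed

theorem ricci_nambu:
  fixes N :: "'p::finite \<Rightarrow> real^'n \<Rightarrow> real^'m"
  assumes card: "CARD('m) = CARD('n) + CARD('p)" and N: "normal_frame G x N W"
  shows "tangent_vec x u (ricci_map h u *v \<xi>) =
         (1 / gamma \<rho> G x u ^ 4) *\<^sub>R
           (\<chi> m. \<Sum>i\<in>UNIV. \<Sum>j\<in>UNIV. \<Sum>k\<in>UNIV. \<Sum>l\<in>UNIV.
              P_sq ord \<rho> G x u $ i $ k * P_sq ord \<rho> G x u $ l $ m * curv_comp G (x u) i j k l * tangent_vec x u \<xi> $ j) +
         (1 / gamma \<rho> G x u ^ 4) *\<^sub>R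
           (\<Sum>A\<in>UNIV. trace (B_map ord \<rho> G x (N A) u) *\<^sub>R (B_map ord \<rho> G x (N A) u *v tangent_vec x u \<xi>) -
              B_map ord \<rho> G x (N A) u *v (B_map ord \<rho> G x (N A) u *v tangent_vec x u \<xi>))"
proof -
  have BB: "B_map ord \<rho> G x (N A) u *v (B_map ord \<rho> G x (N A) u *v (E *v \<xi>)) = \<kappa>\<^sup>2 *\<^sub>R (E *v (weingarten (N A) *v (weingarten (N A) *v \<xi>)))" for A
    by (simp only: B_map_E matrix_vector_mult_scaleR scaleR_scaleR) (simp add: power2_eq_square)
  \<comment> \<open>On tangent vectors \<open>B_map\<close> acts as \<open>- \<kappa>\<close> times
    the Weingarten matrix, and its trace carries the same factor; both quadratic terms thus acquire
    \<open>\<kappa>\<^sup>2\<close>, which the prefactor cancels.\<close>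
  have B: "trace (B_map ord \<rho> G x (N A) u) *\<^sub>R (B_map ord \<rho> G x (N A) u *v (E *v \<xi>)) -
              B_map ord \<rho> G x (N A) u *v (B_map ord \<rho> G x (N A) u *v (E *v \<xi>))
     = \<kappa>\<^sup>2 *\<^sub>R (E *v ((trace (weingarten (N A)) *\<^sub>R weingarten (N A) - weingarten (N A) ** weingarten (N A)) *v \<xi>))" for A
    unfolding BB
    by (simp add: trace_B_map B_map_E matrix_vector_mult_scaleR power2_eq_square scaleR_right_diff_distrib
        matrix_vector_mult_diff_rdistrib matrix_vector_mult_diff_distrib scaleR_matrix_vector_assoc[symmetric]
        matrix_vector_mul_assoc[symmetric])
  have sum_mv: "(\<Sum>A\<in>UNIV. F A *v \<xi>) = (\<Sum>A\<in>UNIV. F A) *v \<xi>" for F :: "'p \<Rightarrow> real^'n^'n"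
    by (simp add: vec_eq_iff matrix_vector_mult_def sum_distrib_right) (subst sum.swap, rule allI, rule refl)
  have sumE: "(\<Sum>A\<in>UNIV. E *v f A) = E *v (\<Sum>A\<in>UNIV. f A)" for f :: "'p \<Rightarrow> real^'n"
    by (simp add: linear_sum[OF matrix_vector_mul_linear])
  show ?thesis
    unfolding tangent_vec_E B scaleR_sum_right[symmetric] sumE sum_mv
    using \<kappa>_nonzero
    by (simp add: vec_eq_iff P_sq_curv(1) gamma_power4 ricci_eq[OF card N] matrix_vector_mult_add_rdistrib matrix_vector_right_distrib)
qed

theorem scalar_nambu:
  fixes N :: "'p::finite \<Rightarrow> real^'n \<Rightarrow> real^'m"
  assumes card: "CARD('m) = CARD('n) + CARD('p)" and N: "normal_frame G x N W"
  shows "scalar_curv h u =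
       (1 / gamma \<rho> G x u ^ 4) *
         (\<Sum>i\<in>UNIV. \<Sum>j\<in>UNIV. \<Sum>k\<in>UNIV. \<Sum>l\<in>UNIV.
            P_sq ord \<rho> G x u $ i $ k * P_sq ord \<rho> G x u $ j $ l * curv_comp G (x u) i j k l) +
       (1 / gamma \<rho> G x u ^ 4) *
         (\<Sum>A\<in>UNIV. (trace (B_map ord \<rho> G x (N A) u))\<^sup>2 -
            trace (B_map ord \<rho> G x (N A) u ** B_map ord \<rho> G x (N A) u))"
proof -
  have "(\<Sum>A\<in>UNIV. (trace (B_map ord \<rho> G x (N A) u))\<^sup>2 - trace (B_map ord \<rho> G x (N A) u ** B_map ord \<rho> G x (N A) u))
    = \<kappa>\<^sup>2 * (\<Sum>A\<in>UNIV. (trace (weingarten (N A)))\<^sup>2 - trace (weingarten (N A) ** weingarten (N A)))"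
    by (simp add: trace_B_map trace_B_map_sq power_mult_distrib sum_distrib_left right_diff_distrib)
  then show ?thesis
    using \<kappa>_nonzero
    by (simp add: scalar_curv_def ricci_eq[OF card N] trace_add trace_sum trace_sub trace_scaleR P_sq_curv(2) gamma_power4 power2_eq_square)
qed

end

end

section \<open>From charts and embeddings to a submanifold patch\<close>

lemma invertible_if_pos_def:
  fixes A :: "real^'n^'n::finite"
  assumes "\<And>v. v \<noteq> 0 \<Longrightarrow> v \<bullet> (A *v v) > 0"
  shows "invertible A"
proof -
  have "\<forall>v. A *v v = 0 \<longrightarrow> v = 0" using assms by force
  then show ?thesis by (simp add: invertible_left_inverse matrix_left_invertible_ker)
qed

text \<open>The quadratic form of the induced metric at \<open>\<xi>\<close> is the ambient squared
  length of the image of \<open>\<xi>\<close> under the differential of \<open>x\<close>, which is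
  nonzero for an injective differential.\<close>

lemma induced_metric_invertible:
  fixes G :: "real^'m::finite \<Rightarrow> real^'m^'m" and x :: "real^'n::finite \<Rightarrow> real^'m"
  assumes pos: "\<And>v. v \<noteq> 0 \<Longrightarrow> v \<bullet> (G (x u) *v v) > 0"
    and x: "x differentiable at u" "inj (frechet_derivative x (at u))"
  shows "invertible (induced_metric G x u)"
proof (rule invertible_if_pos_def)
  fix \<xi> :: "real^'n" assume "\<xi> \<noteq> 0"
  have T: "frechet_derivative x (at u) \<xi> = tangent_vec x u \<xi>" for \<xi>
    by (simp add: frechet_derivative_eq_partial[OF x(1)] tangent_vec_def)
  have "tangent_vec x u \<xi> \<noteq> tangent_vec x u 0"
    using x(2) \<open>\<xi> \<noteq> 0\<close> unfolding T[symmetric] inj_def by blast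
  then have "tangent_vec x u \<xi> \<noteq> 0" by (simp add: tangent_vec_def)
  then have "metric G (x u) (tangent_vec x u \<xi>) (tangent_vec x u \<xi>) > 0"
    using pos by (simp add: metric_inner)
  also have "metric G (x u) (tangent_vec x u \<xi>) (tangent_vec x u \<xi>) = \<xi> \<bullet> (induced_metric G x u *v \<xi>)"
    by (simp add: tangent_vec_def metric_linear inner_vec_def matrix_vector_mult_def induced_metric_def sum_distrib_left)
      (subst sum.swap, simp add: mult_ac)
  finally show "\<xi> \<bullet> (induced_metric G x u *v \<xi>) > 0" .
qed

text \<open>\<open>local_rep\<close> inverts the chart by \<open>inv_into\<close>; injectivity of
  the chart on its domain ensures that the chosen preimage is the point \<open>s\<close> at which
  \<open>f s\<close> is known to lie in the target chart.\<close>

lemma local_rep_mem: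
  assumes c: "is_chart X c" and u: "u \<in> local_dom c d f"
  shows "local_rep c d f u \<in> snd d ` fst d"
proof -
  obtain s where s: "s \<in> fst c" "f s \<in> fst d" "u = snd c s"
    using u by (auto simp: local_dom_def)
  have "topspace (subtopology X (fst c)) = fst c"
    using c by (auto simp: is_chart_def dest: openin_subset)
  then have "inj_on (snd c) (fst c)"
    using c homeomorphic_imp_injective_map by (fastforce simp: is_chart_def)
  then show ?thesis using s by (simp add: local_rep_def)
qed

theorem theorem3p7:
  fixes M :: "'q topology" and \<A>\<^sub>M :: "('q, 'm::finite) chart set"
    and G\<^sub>M :: "('q, 'm) chart \<Rightarrow> real^'m \<Rightarrow> real^'m^'m"
    and \<Sigma> :: "'s topology" and \<A>\<^sub>\<Sigma> :: "('s, 'n::finite) chart set"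
    and emb :: "'s \<Rightarrow> 'q"
    and c :: "('s, 'n) chart" and d :: "('q, 'm) chart"
    and G :: "real^'m \<Rightarrow> real^'m^'m" and x :: "real^'n \<Rightarrow> real^'m"
    and N :: "'p::finite \<Rightarrow> real^'n \<Rightarrow> real^'m"
    and \<rho> :: "real^'n \<Rightarrow> real" and ord :: "nat \<Rightarrow> 'n"
    and W :: "(real^'n) set" and u :: "real^'n"
  assumes "CARD('n) \<ge> 2" and "CARD('m) = CARD('n) + CARD('p)"
    and "riemannian_manifold M \<A>\<^sub>M G\<^sub>M"
    and "smooth_manifold \<Sigma> \<A>\<^sub>\<Sigma>"
    and "smooth_embedding \<Sigma> \<A>\<^sub>\<Sigma> M \<A>\<^sub>M emb"
    and "c \<in> \<A>\<^sub>\<Sigma>" and "d \<in> \<A>\<^sub>M"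
    and "x = local_rep c d emb" and "G = G\<^sub>M d"
    and "open W" and "W \<subseteq> local_dom c d emb"
    and "normal_frame G x N W"
    and "bij_betw ord {..<CARD('n)} UNIV"
    and "\<forall>v\<in>W. \<rho> v \<noteq> 0"
    and "u \<in> W"
  shows
    "(\<forall>\<xi> X. X = tangent_vec x u \<xi> \<longrightarrow>
       tangent_vec x u (ricci_map (induced_metric G x) u *v \<xi>) =
         (1 / gamma \<rho> G x u ^ 4) *\<^sub>R
           (\<chi> m. \<Sum>i\<in>UNIV. \<Sum>j\<in>UNIV. \<Sum>k\<in>UNIV. \<Sum>l\<in>UNIV.
              P_sq ord \<rho> G x u $ i $ k * P_sq ord \<rho> G x u $ l $ m * curv_comp G (x u) i j k l * X $ j) +
         (1 / gamma \<rho> G x u ^ 4) *\<^sub>R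
           (\<Sum>A\<in>UNIV. trace (B_map ord \<rho> G x (N A) u) *\<^sub>R (B_map ord \<rho> G x (N A) u *v X) -
              B_map ord \<rho> G x (N A) u *v (B_map ord \<rho> G x (N A) u *v X))) \<and>
     scalar_curv (induced_metric G x) u =
       (1 / gamma \<rho> G x u ^ 4) *
         (\<Sum>i\<in>UNIV. \<Sum>j\<in>UNIV. \<Sum>k\<in>UNIV. \<Sum>l\<in>UNIV.
            P_sq ord \<rho> G x u $ i $ k * P_sq ord \<rho> G x u $ j $ l * curv_comp G (x u) i j k l) +
       (1 / gamma \<rho> G x u ^ 4) *
         (\<Sum>A\<in>UNIV. (trace (B_map ord \<rho> G x (N A) u))\<^sup>2 -
            trace (B_map ord \<rho> G x (N A) u ** B_map ord \<rho> G x (N A) u))"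
proof -
  let ?U = "snd d ` fst d"
  have G: "smooth_on G ?U" "\<And>y. y \<in> ?U \<Longrightarrow> transpose (G y) = G y"
    "\<And>y v. y \<in> ?U \<Longrightarrow> v \<noteq> 0 \<Longrightarrow> v \<bullet> (G y *v v) > 0"
    using assms(3,7,9) by (auto simp: riemannian_manifold_def riemannian_metric_def)
  have x: "smooth_on x (local_dom c d emb)"
    "\<And>v. v \<in> local_dom c d emb \<Longrightarrow> inj (frechet_derivative x (at v))"
    using assms(5-8) by (auto simp: smooth_embedding_def)
  have x_in: "x v \<in> ?U" if "v \<in> W" for v
    using local_rep_mem[of \<Sigma> c v d emb] assms(4,6,8,11) that by (auto simp: smooth_manifold_def)
  have smooth_x: "smooth_on x W" using x(1) assms(10,11) by (rule smooth_on_subset)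
  interpret submanifold_patch G x ?U W
  proof
    show "invertible (induced_metric G x v)" if "v \<in> W" for v
      using that assms(11) by (intro induced_metric_invertible G(3) x_in x(2) smooth_on_differentiable[OF smooth_x]) auto
    show "invertible (G y)" if "y \<in> ?U" for y
      using that by (intro invertible_if_pos_def G(3))
  qed (use G smooth_x x_in in auto)
  have "\<rho> u \<noteq> 0" using assms(14,15) by blast
  note hyps = assms(13,15) this assms(2,12)
  show ?thesis using ricci_nambu[where ord = ord and u = u and \<rho> = \<rho> and N = N, OF hyps]
      scalar_nambu[where ord = ord and u = u and \<rho> = \<rho> and N = N, OF hyps] by blast
qed

end
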